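(* For a circuit with input state of particle number exactly $k$ and a particle-number-preserving observable, apply to each layer, with independent random sign vectors, the unbiased parallel parameter-shift estimators for the RBS gradients ($2k$ circuit evaluations per layer) and for the $R_z$ gradients ($2k$ circuit evaluations per layer). Then the full gradient of the loss with respect to all trainable parameters is estimated (unbiasedly) at the following costs. (1) Butterfly ($n=2^K$, $K=\log_2n$ layers, $T=\frac32n\log_2n$ parameters): $2k\log_2n$ circuit evaluations for all RBS gradients and $2k\log_2n$ for all $R_z$ gradients, $4k\log_2n$ in total. The naive parameter-shift rule ($4$ evaluations per RBS parameter and $2$ per $R_z$ parameter) requires $4n\log_2n$; the reduction factor is $n/k$. (2) Brick-wall ($K=n$ columns, each a full-width $R_z$ layer followed by $n/2$ RBS gates, $T=3n^2/2$ parameters): $2kn$ circuit evaluations for all RBS gradients and $2kn$ for all $R_z$ gradients, $4kn$ in total. The naive parameter-shift rule requires $4\cdot n^2/2+2\cdot n^2=4n^2$; the reduction factor is exactly $n/k$. At $k=60$ the butterfly cost is $240\log_2n$ circuit evaluations per gradient step.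
   Context: Qubits are called modes. $\mathrm{RBS}(\theta)$ is, in the basis $|00\rangle,|01\rangle,|10\rangle,|11\rangle$, $\begin{pmatrix}1&0&0&0\\0&\cos\theta&\sin\theta&0\\0&-\sin\theta&\cos\theta&0\\0&0&0&1\end{pmatrix}$; $R_z(\phi)=\mathrm{diag}(e^{i\phi/2},e^{-i\phi/2})$. Circuit $U=U^{(K)}\cdots U^{(1)}$, $U^{(\ell)}=\big[\bigotimes_{j=1}^{n/2}\mathrm{RBS}(\theta_\ell^{(j)})\big]\bigotimes_{i=1}^nR_z(\phi_\ell^{(i)})$, the $n/2$ RBS gates of each layer acting on disjoint pairs covering all $n$ qubits: for the butterfly, layer $\ell$ pairs qubits whose binary labels differ exactly in bit $\ell-1$; for the brick-wall ($n$ even), odd columns use $(1,2),(3,4),\dots$ and even columns $(2,3),\dots,(n-2,n-1),(n,1)$. Loss $\mathcal L=\langle\psi|U^\dagger MU|\psi\rangle$, $|\psi\rangle$ in the span of Hamming-weight-$k$ basis states, $M$ commuting with the Hamming-weight operator. A circuit evaluation is the evaluation of $\mathcal L$ at one parameter configuration. Parallel parameter-shift estimators: fix reals $a_q,r_q$ ($q=1,\dots,k$) with $\sum_qa_q\sin r_q\cos^{2m-1}r_q=\frac12$ for $m=1,\dots,k$. For layer $\ell$ and a uniform sign vector $s\in\{\pm1\}^{n/2}$, the RBS estimator is $\hat g_j(s)=s_j\sum_qa_q[\mathcal L(\theta_\ell+r_qs)-\mathcal L(\theta_\ell-r_qs)]$, $j=1,\dots,n/2$; for a uniform $s\in\{\pm1\}^n$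 the $R_z$ estimator is $\hat h_j(s)=s_j\sum_qa_q[\mathcal L(\phi_\ell+r_qs)-\mathcal L(\phi_\ell-r_qs)]$, $j=1,\dots,n$ (other parameters fixed). *)

theory Defs
  imports
    "HOL-Probability.Probability"
    "HOL-Probability.Product_PMF"
    "Jordan_Normal_Form.Schur_Decomposition"
    "Jordan_Normal_Form.VS_Connect"
begin

hide_const (open) Finite_Cartesian_Product.mat Finite_Cartesian_Product.vec

text \<open>
  Indexing conventions. Qubits and the gates inside a layer are numbered from 0; layers (columns)
  and the shift index of the parameter-shift rule are numbered from 1.
  A basis state of \<open>n\<close> qubits is a number \<open>x < 2 ^ n\<close>, the value of qubit \<open>i\<close> being bit \<open>i\<close> of \<open>x\<close>.
\<close>

section \<open>Gates, layers and circuits\<close>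

definition qbit :: "nat \<Rightarrow> nat \<Rightarrow> nat" where
  "qbit x i = of_bool (bit x i)"

definition RBS :: "real \<Rightarrow> complex mat" where
  "RBS t = mat_of_rows_list 4
     [[1, 0, 0, 0],
      [0, complex_of_real (cos t), complex_of_real (sin t), 0],
      [0, - complex_of_real (sin t), complex_of_real (cos t), 0],
      [0, 0, 0, 1]]"

definition Rz :: "real \<Rightarrow> complex mat" where
  "Rz t = mat_of_rows_list 2 [[cis (t / 2), 0], [0, cis (- t / 2)]]"

text \<open>
  A pairing \<open>p\<close> assigns to gate \<open>j < n div 2\<close> the ordered pair of qubits that it acts on: the first
  component is the left factor in the basis 00, 01, 10, 11. The tensor products are given by their
  matrix entries, the products of the entries of the factors. For the RBS gates this requires that
  the pairs are disjoint and cover all qubits.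
\<close>

definition perfect_pairing :: "nat \<Rightarrow> (nat \<Rightarrow> nat \<times> nat) \<Rightarrow> bool" where
  "perfect_pairing n p \<longleftrightarrow>
     bij_betw (\<lambda>(j, b). if b then snd (p j) else fst (p j)) ({..<n div 2} \<times> UNIV) {..<n}"

definition RBS_layer :: "nat \<Rightarrow> (nat \<Rightarrow> nat \<times> nat) \<Rightarrow> (nat \<Rightarrow> real) \<Rightarrow> complex mat" where
  "RBS_layer n p \<theta> = Matrix.mat (2 ^ n) (2 ^ n) (\<lambda>(x, y). \<Prod>j<n div 2.
     RBS (\<theta> j) $$ (2 * qbit x (fst (p j)) + qbit x (snd (p j)),
                   2 * qbit y (fst (p j)) + qbit y (snd (p j))))"

definition Rz_layer :: "nat \<Rightarrow> (nat \<Rightarrow> real) \<Rightarrow> complex mat" where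
  "Rz_layer n \<phi> = Matrix.mat (2 ^ n) (2 ^ n) (\<lambda>(x, y). \<Prod>i<n. Rz (\<phi> i) $$ (qbit x i, qbit y i))"

text \<open>A configuration \<open>(\<theta>, \<phi>)\<close> holds the RBS angle \<open>\<theta> l j\<close> and the \<open>R\<^sub>z\<close> angle \<open>\<phi> l i\<close> of layer \<open>l\<close>.\<close>

type_synonym config = "(nat \<Rightarrow> nat \<Rightarrow> real) \<times> (nat \<Rightarrow> nat \<Rightarrow> real)"

primrec circuit :: "nat \<Rightarrow> (nat \<Rightarrow> nat \<Rightarrow> nat \<times> nat) \<Rightarrow> nat \<Rightarrow> config \<Rightarrow> complex mat" where
  "circuit n pr 0 c = 1\<^sub>m (2 ^ n)"
| "circuit n pr (Suc L) c =
     (RBS_layer n (pr (Suc L)) (fst c (Suc L)) * Rz_layer n (snd c (Suc L))) * circuit n pr L c"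

definition butterfly_pairing :: "nat \<Rightarrow> (nat \<Rightarrow> nat \<Rightarrow> nat \<times> nat) \<Rightarrow> bool" where
  "butterfly_pairing K pr \<longleftrightarrow> (\<forall>l\<in>{1..K}. perfect_pairing (2 ^ K) (pr l) \<and>
     (\<forall>j<2 ^ K div 2. \<forall>b. (bit (fst (pr l j)) b \<noteq> bit (snd (pr l j)) b) \<longleftrightarrow> b = l - 1))"

definition brickwall :: "nat \<Rightarrow> nat \<Rightarrow> nat \<Rightarrow> nat \<times> nat" where
  "brickwall n l j = (if odd l then (2 * j, 2 * j + 1) else (2 * j + 1, (2 * j + 2) mod n))"

section \<open>Input states, observables and the loss\<close>

definition hamming_weight :: "nat \<Rightarrow> nat \<Rightarrow> nat" where
  "hamming_weight n x = card {i. i < n \<and> bit x i}"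

definition weight_operator :: "nat \<Rightarrow> complex mat" where
  "weight_operator n =
     Matrix.mat (2 ^ n) (2 ^ n) (\<lambda>(x, y). if x = y then of_nat (hamming_weight n x) else 0)"

definition weight_subspace :: "nat \<Rightarrow> nat \<Rightarrow> complex Matrix.vec set" where
  "weight_subspace n k =
     LinearCombinations.module.span class_ring (module_vec TYPE(complex) (2 ^ n))
       {unit_vec (2 ^ n) x | x. x < 2 ^ n \<and> hamming_weight n x = k}"

definition input_state :: "nat \<Rightarrow> nat \<Rightarrow> complex Matrix.vec \<Rightarrow> bool" where
  "input_state n k \<psi> \<longleftrightarrow> \<psi> \<in> weight_subspace n k \<and> \<psi> \<bullet>c \<psi> = 1"

definition preserving_observable :: "nat \<Rightarrow> complex mat \<Rightarrow> bool" where
  "preserving_observable n M \<longleftrightarrow> M \<in> carrier_mat (2 ^ n) (2 ^ n) \<and> mat_adjoint M = M \<and>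
     M * weight_operator n = weight_operator n * M"

text \<open>For a self-adjoint \<open>M\<close> the expectation value is real, so that taking the real part only
  changes the type (lemma \<open>loss_real\<close> below).\<close>

definition loss :: "nat \<Rightarrow> (nat \<Rightarrow> nat \<Rightarrow> nat \<times> nat) \<Rightarrow> nat \<Rightarrow> complex mat \<Rightarrow> complex Matrix.vec
    \<Rightarrow> config \<Rightarrow> real" where
  "loss n pr K M \<psi> c =
     (let U = circuit n pr K c in Re (((mat_adjoint U * M * U) *\<^sub>v \<psi>) \<bullet>c \<psi>))"

section \<open>Procedures that evaluate the loss\<close>

text \<open>
  A procedure has access to the loss only through \<open>Evaluate c\<close>, which is one circuit evaluation at
  the configuration \<open>c\<close>. \<open>run\<close> is the output and \<open>evals\<close> the number of circuit evaluations.
\<close>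

datatype 'a procedure = Return 'a | Evaluate config "real \<Rightarrow> 'a procedure"

primrec run :: "(config \<Rightarrow> real) \<Rightarrow> 'a procedure \<Rightarrow> 'a" where
  "run L (Return x) = x"
| "run L (Evaluate c f) = run L (f (L c))"

primrec evals :: "(config \<Rightarrow> real) \<Rightarrow> 'a procedure \<Rightarrow> nat" where
  "evals L (Return x) = 0"
| "evals L (Evaluate c f) = Suc (evals L (f (L c)))"

primrec bind :: "'a procedure \<Rightarrow> ('a \<Rightarrow> 'b procedure) \<Rightarrow> 'b procedure" where
  "bind (Return x) g = g x"
| "bind (Evaluate c f) g = Evaluate c (\<lambda>v. bind (f v) g)"

primrec for_each :: "'i list \<Rightarrow> ('i \<Rightarrow> 'a procedure) \<Rightarrow> ('i \<Rightarrow> 'a) procedure" where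
  "for_each [] f = Return (\<lambda>_. undefined)"
| "for_each (x # xs) f =
     bind (f x) (\<lambda>v. bind (for_each xs f) (\<lambda>h. Return (h(x := v))))"

definition difference :: "config \<Rightarrow> config \<Rightarrow> real procedure" where
  "difference c c' = Evaluate c (\<lambda>u. Evaluate c' (\<lambda>v. Return (u - v)))"

section \<open>Parallel parameter-shift estimators\<close>

definition shift_RBS :: "config \<Rightarrow> nat \<Rightarrow> (nat \<Rightarrow> real) \<Rightarrow> config" where
  "shift_RBS c l d = ((fst c)(l := (\<lambda>j. fst c l j + d j)), snd c)"

definition shift_Rz :: "config \<Rightarrow> nat \<Rightarrow> (nat \<Rightarrow> real) \<Rightarrow> config" where
  "shift_Rz c l d = (fst c, (snd c)(l := (\<lambda>i. snd c l i + d i)))"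

definition shift_coefficients :: "nat \<Rightarrow> (nat \<Rightarrow> real) \<Rightarrow> (nat \<Rightarrow> real) \<Rightarrow> bool" where
  "shift_coefficients k a r \<longleftrightarrow>
     (\<forall>m\<in>{1..k}. (\<Sum>q=1..k. a q * sin (r q) * cos (r q) ^ (2 * m - 1)) = 1 / 2)"

text \<open>The argument \<open>sh\<close> is \<open>shift_RBS c\<close> or \<open>shift_Rz c\<close>; the output is the vector of the estimates
  for all parameters of the layer.\<close>

definition layer_estimate :: "nat \<Rightarrow> (nat \<Rightarrow> real) \<Rightarrow> (nat \<Rightarrow> real) \<Rightarrow>
    (nat \<Rightarrow> (nat \<Rightarrow> real) \<Rightarrow> config) \<Rightarrow> nat \<Rightarrow> (nat \<Rightarrow> real) \<Rightarrow> (nat \<Rightarrow> real) procedure" where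
  "layer_estimate k a r sh l s =
     bind (for_each [1..<Suc k]
            (\<lambda>q. difference (sh l (\<lambda>j. r q * s j)) (sh l (\<lambda>j. - (r q * s j)))))
          (\<lambda>D. Return (\<lambda>j. s j * (\<Sum>q=1..k. a q * D q)))"

definition RBS_estimate :: "nat \<Rightarrow> (nat \<Rightarrow> real) \<Rightarrow> (nat \<Rightarrow> real) \<Rightarrow> nat \<Rightarrow> config \<Rightarrow>
    (nat \<Rightarrow> nat \<Rightarrow> real) \<Rightarrow> (nat \<Rightarrow> nat \<Rightarrow> real) procedure" where
  "RBS_estimate k a r K c S = for_each [1..<Suc K] (\<lambda>l. layer_estimate k a r (shift_RBS c) l (S l))"

definition Rz_estimate :: "nat \<Rightarrow> (nat \<Rightarrow> real) \<Rightarrow> (nat \<Rightarrow> real) \<Rightarrow> nat \<Rightarrow> config \<Rightarrow>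
    (nat \<Rightarrow> nat \<Rightarrow> real) \<Rightarrow> (nat \<Rightarrow> nat \<Rightarrow> real) procedure" where
  "Rz_estimate k a r K c S = for_each [1..<Suc K] (\<lambda>l. layer_estimate k a r (shift_Rz c) l (S l))"

text \<open>The seed is a pair: the sign vectors of all layers for the RBS gradients and those for the
  \<open>R\<^sub>z\<close> gradients. The output has the shape of a configuration.\<close>

type_synonym seed = "(nat \<Rightarrow> nat \<Rightarrow> real) \<times> (nat \<Rightarrow> nat \<Rightarrow> real)"

definition gradient_estimate :: "nat \<Rightarrow> (nat \<Rightarrow> real) \<Rightarrow> (nat \<Rightarrow> real) \<Rightarrow> nat \<Rightarrow> config \<Rightarrow>
    seed \<Rightarrow> config procedure" where
  "gradient_estimate k a r K c S =
     bind (RBS_estimate k a r K c (fst S)) (\<lambda>g.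
     bind (Rz_estimate k a r K c (snd S)) (\<lambda>h. Return (g, h)))"

definition sign_vectors :: "nat \<Rightarrow> (nat \<Rightarrow> real) set" where
  "sign_vectors m = {..<m} \<rightarrow>\<^sub>E {-1, 1}"

definition layer_signs :: "nat \<Rightarrow> nat \<Rightarrow> (nat \<Rightarrow> nat \<Rightarrow> real) pmf" where
  "layer_signs K m = Pi_pmf {1..K} (\<lambda>_. undefined) (\<lambda>_. pmf_of_set (sign_vectors m))"

definition seed_pmf :: "nat \<Rightarrow> nat \<Rightarrow> seed pmf" where
  "seed_pmf n K = pair_pmf (layer_signs K (n div 2)) (layer_signs K n)"

definition trainable_parameters :: "nat \<Rightarrow> nat \<Rightarrow> (nat \<times> nat + nat \<times> nat) set" where
  "trainable_parameters n K = ({1..K} \<times> {..<n div 2}) <+> ({1..K} \<times> {..<n})"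

definition unbiased_gradient :: "nat \<Rightarrow> nat \<Rightarrow> (config \<Rightarrow> real) \<Rightarrow> config \<Rightarrow>
    seed pmf \<Rightarrow> (seed \<Rightarrow> config procedure) \<Rightarrow> bool" where
  "unbiased_gradient n K L c P est \<longleftrightarrow> (\<forall>l\<in>{1..K}.
     (\<forall>j<n div 2.
       ((\<lambda>t. L ((fst c)(l := (fst c l)(j := t)), snd c)) has_real_derivative
          measure_pmf.expectation P (\<lambda>S. fst (run L (est S)) l j)) (at (fst c l j))) \<and>
     (\<forall>i<n.
       ((\<lambda>t. L (fst c, (snd c)(l := (snd c l)(i := t)))) has_real_derivative
          measure_pmf.expectation P (\<lambda>S. snd (run L (est S)) l i)) (at (snd c l i))))"

section \<open>The naive parameter-shift rule\<close>

text \<open>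
  As a function of one RBS angle the loss is a trigonometric polynomial with frequencies 0, 1, 2;
  as a function of one \<open>R\<^sub>z\<close> angle it has frequencies 0, 1. The naive rule applies, to one parameter
  at a time, the four-term and the two-term shift rules that are exact on such functions
  (lemmas \<open>four_term_rule_exact\<close> and \<open>two_term_rule_exact\<close> below).
\<close>

definition naive_RBS :: "config \<Rightarrow> nat \<times> nat \<Rightarrow> real procedure" where
  "naive_RBS c = (\<lambda>(l, j). let shift = (\<lambda>x. shift_RBS c l ((\<lambda>_. 0)(j := x))) in
     bind (difference (shift (pi / 4)) (shift (- (pi / 4)))) (\<lambda>u.
     bind (difference (shift (3 * pi / 4)) (shift (- (3 * pi / 4)))) (\<lambda>v.
     Return ((2 + sqrt 2) / 4 * u - (2 - sqrt 2) / 4 * v))))"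

definition naive_Rz :: "config \<Rightarrow> nat \<times> nat \<Rightarrow> real procedure" where
  "naive_Rz c = (\<lambda>(l, i). let shift = (\<lambda>x. shift_Rz c l ((\<lambda>_. 0)(i := x))) in
     bind (difference (shift (pi / 2)) (shift (- (pi / 2)))) (\<lambda>u. Return (u / 2)))"

definition naive_gradient :: "nat \<Rightarrow> nat \<Rightarrow> config \<Rightarrow> config procedure" where
  "naive_gradient n K c =
     bind (for_each (List.product [1..<Suc K] [0..<n div 2]) (naive_RBS c)) (\<lambda>g.
     bind (for_each (List.product [1..<Suc K] [0..<n]) (naive_Rz c)) (\<lambda>h.
     Return (curry g, curry h)))"

section \<open>Consistency checks\<close>

lemma evals_bind: "evals L (bind p g) = evals L p + evals L (g (run L p))"
  by (induction p) auto

lemma run_bind: "run L (bind p g) = run L (g (run L p))"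
  by (induction p) auto

lemma run_for_each: "x \<in> set xs \<Longrightarrow> run L (for_each xs f) x = run L (f x)"
  by (induction xs) (auto simp: run_bind)

lemma run_layer_estimate:
  "run L (layer_estimate k a r sh l s) j =
     s j * (\<Sum>q=1..k. a q * (L (sh l (\<lambda>j. r q * s j)) - L (sh l (\<lambda>j. - (r q * s j)))))"
proof -
  have "(\<Sum>q=1..k. a q * run L (for_each [1..<Suc k]
            (\<lambda>q. difference (sh l (\<lambda>j. r q * s j)) (sh l (\<lambda>j. - (r q * s j))))) q) =
        (\<Sum>q=1..k. a q * (L (sh l (\<lambda>j. r q * s j)) - L (sh l (\<lambda>j. - (r q * s j)))))"
    by (rule sum.cong[OF refl], subst run_for_each) (auto simp: difference_def)
  then show ?thesis
    by (simp add: layer_estimate_def run_bind del: upt_Suc)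
qed

lemma two_term_rule_exact:
  fixes f :: "real \<Rightarrow> real"
  assumes "\<And>t. f t = A + B * cos t + C * sin t"
  shows "(f has_real_derivative (f (x + pi / 2) - f (x + - (pi / 2))) / 2) (at x)"
proof -
  have "f = (\<lambda>t. A + B * cos t + C * sin t)" using assms by auto
  moreover have "((\<lambda>t. A + B * cos t + C * sin t) has_real_derivative (- B * sin x + C * cos x)) (at x)"
    by (auto intro!: derivative_eq_intros)
  ultimately show ?thesis
    by (simp add: sin_add cos_add sin_diff cos_diff diff_divide_distrib)
qed

lemma four_term_rule_exact:
  fixes f :: "real \<Rightarrow> real"
  assumes "\<And>t. f t = A + B * cos t + C * sin t + D * cos (2 * t) + E * sin (2 * t)"
  shows "(f has_real_derivative (2 + sqrt 2) / 4 * (f (x + pi / 4) - f (x + - (pi / 4)))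
            - (2 - sqrt 2) / 4 * (f (x + 3 * pi / 4) - f (x + - (3 * pi / 4)))) (at x)"
proof -
  have f: "f = (\<lambda>t. A + B * cos t + C * sin t + D * cos (2 * t) + E * sin (2 * t))"
    using assms by auto
  have deriv: "(f has_real_derivative
      (- B * sin x + C * cos x - 2 * D * sin (2 * x) + 2 * E * cos (2 * x))) (at x)"
    unfolding f by (auto intro!: derivative_eq_intros)
  have s3: "sin (3 * pi / 4) = sqrt 2 / 2" "cos (3 * pi / 4) = - sqrt 2 / 2"
    using sin_pi_minus[of "pi / 4"] cos_pi_minus[of "pi / 4"]
    by (simp_all add: sin_45 cos_45 field_simps)
  have s6: "sin (3 * pi / 2) = - 1" "cos (3 * pi / 2) = 0"
    using sin_3over2_pi cos_3over2_pi by (simp_all add: field_simps)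
  have e1: "f (x + pi / 4) - f (x + - (pi / 4)) =
      2 * (sqrt 2 / 2) * (- B * sin x + C * cos x) - 2 * D * sin (2 * x) + 2 * E * cos (2 * x)"
    by (simp add: assms distrib_left right_diff_distrib sin_add cos_add sin_diff cos_diff sin_45 cos_45)
  have e2: "f (x + 3 * pi / 4) - f (x + - (3 * pi / 4)) =
      2 * (sqrt 2 / 2) * (- B * sin x + C * cos x) + 2 * D * sin (2 * x) - 2 * E * cos (2 * x)"
  proof -
    have "2 * (x + 3 * pi / 4) = 2 * x + 3 * pi / 2" "2 * (x - 3 * pi / 4) = 2 * x - 3 * pi / 2"
      by (simp_all add: field_simps)
    then show ?thesis
      by (simp add: assms sin_add cos_add sin_diff cos_diff s3 s6) (simp add: algebra_simps)
  qed
  have "(2 + sqrt 2) / 4 * (f (x + pi / 4) - f (x + - (pi / 4)))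
            - (2 - sqrt 2) / 4 * (f (x + 3 * pi / 4) - f (x + - (3 * pi / 4))) =
        (sqrt 2 * sqrt 2) / 2 * (- B * sin x + C * cos x) - 2 * D * sin (2 * x) + 2 * E * cos (2 * x)"
    unfolding e1 e2 by (simp add: algebra_simps add_divide_distrib diff_divide_distrib)
  also have "sqrt 2 * sqrt 2 = (2::real)" by simp
  finally show ?thesis using deriv by simp
qed

lemma circuit_carrier: "circuit n pr K c \<in> carrier_mat (2 ^ n) (2 ^ n)"
  by (induction K) (auto simp: RBS_layer_def Rz_layer_def)

lemma perfect_pairingI:
  assumes "\<And>j. j < n div 2 \<Longrightarrow> fst (p j) < n \<and> snd (p j) < n"
    and "even n"
    and "inj_on (\<lambda>(j, b). if b then snd (p j) else fst (p j)) ({..<n div 2} \<times> UNIV)"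
  shows "perfect_pairing n p"
proof -
  let ?h = "\<lambda>(j, b). if b then snd (p j) else fst (p j)"
  have "?h ` ({..<n div 2} \<times> UNIV) = {..<n}"
  proof (rule card_subset_eq)
    show "?h ` ({..<n div 2} \<times> UNIV) \<subseteq> {..<n}" using assms(1) by (auto split: if_splits)
    show "card (?h ` ({..<n div 2} \<times> UNIV)) = card {..<n}"
      using \<open>even n\<close> by (simp add: card_image[OF assms(3)] card_cartesian_product)
  qed simp
  then show ?thesis using assms(3) by (simp add: perfect_pairing_def bij_betw_def)
qed

lemma perfect_pairing_brickwall:
  assumes "even n"
  shows "perfect_pairing n (brickwall n l)"
proof (rule perfect_pairingI[OF _ assms])
  obtain m where n: "n = 2 * m" using assms by blast
  have md: "(2 * j + 2) mod n = (if Suc j = m then 0 else 2 * j + 2)" if "j < m" for j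
    using that by (auto simp: n)
  show "fst (brickwall n l j) < n \<and> snd (brickwall n l j) < n" if "j < n div 2" for j
    using that by (auto simp: brickwall_def n)
  show "inj_on (\<lambda>(j, b). if b then snd (brickwall n l j) else fst (brickwall n l j))
          ({..<n div 2} \<times> UNIV)"
  proof (cases "odd l")
    case True
    then show ?thesis by (auto simp: inj_on_def brickwall_def) presburger+
  next
    case False
    have "even ((2 * j + 2) mod n)" for j using assms by (simp add: dvd_mod_iff)
    then have ne: "2 * j' + 1 \<noteq> (2 * j + 2) mod n" for j j'
      by (metis odd_two_times_div_two_succ even_add even_mult_iff odd_one even_numeral)
    have eq: "j = j'" if "(2 * j + 2) mod n = (2 * j' + 2) mod n" "j < m" "j' < m" for j j'
      using that md[of j] md[of j'] by (auto split: if_splits)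
    show ?thesis
    proof (rule inj_onI, clarify)
      fix j b j' b'
      assume "j < n div 2" "j' < n div 2"
        "(if b then snd (brickwall n l j) else fst (brickwall n l j)) =
         (if b' then snd (brickwall n l j') else fst (brickwall n l j'))"
      then show "j = j' \<and> b = b'"
        using False eq[of j j'] ne[of j j'] ne[of j' j]
        by (auto simp: brickwall_def n split: if_splits)
    qed
  qed
qed

lemma ex_butterfly_pairing: "\<exists>pr. butterfly_pairing K pr"
proof -
  have "\<exists>p. perfect_pairing (2 ^ K) p \<and>
     (\<forall>j<2 ^ K div 2. \<forall>b. (bit (fst (p j)) b \<noteq> bit (snd (p j)) b) \<longleftrightarrow> b = i)" if i: "i < K" for i
  proof -
    define A where "A = {x. x < (2::nat) ^ K \<and> \<not> bit x i}"
    have bitflip: "bit (flip_bit i x) b \<longleftrightarrow> (bit x b \<noteq> (b = i))" for x b :: nat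
      by (auto simp: bit_flip_bit_iff)
    have flip2: "flip_bit i (flip_bit i x) = x" for x :: nat
      by (rule bit_eqI) (auto simp: bitflip)
    have flip_lt: "flip_bit i x < 2 ^ K" if "x < 2 ^ K" for x :: nat
    proof -
      have "take_bit K x = x" using that by (simp add: take_bit_nat_eq_self_iff)
      then have "b < K" if "bit x b" for b using that by (metis bit_take_bit_iff)
      then have "take_bit K (flip_bit i x) = flip_bit i x"
        using i by (intro bit_eqI) (auto simp: bit_take_bit_iff bitflip)
      then show ?thesis by (simp add: take_bit_nat_eq_self_iff)
    qed
    have finA: "finite A" by (simp add: A_def)
    have inj: "inj_on (flip_bit i) A" by (metis flip2 inj_onI)
    have dis: "A \<inter> flip_bit i ` A = {}" by (auto simp: A_def bitflip)
    have un: "A \<union> flip_bit i ` A = {..<2 ^ K}"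
    proof
      show "A \<union> flip_bit i ` A \<subseteq> {..<2 ^ K}" by (auto simp: A_def flip_lt)
      show "{..<2 ^ K} \<subseteq> A \<union> flip_bit i ` A"
      proof
        fix x :: nat assume "x \<in> {..<2 ^ K}"
        then have "x \<in> A \<or> flip_bit i x \<in> A" by (auto simp: A_def flip_lt bitflip)
        then show "x \<in> A \<union> flip_bit i ` A" by (metis UnCI flip2 image_eqI)
      qed
    qed
    have "card A + card A = 2 ^ K"
      using card_Un_disjoint[OF finA _ dis] card_image[OF inj] finA un by simp
    then have cA: "card A = 2 ^ K div 2" by simp
    obtain g where g: "bij_betw g {..<card A} A"
      using ex_bij_betw_nat_finite[OF finA] by (auto simp: atLeast0LessThan)
    define p where "p j = (g j, flip_bit i (g j))" for j
    have gA: "g j \<in> A" if "j < 2 ^ K div 2" for j using g that by (auto simp: cA bij_betw_def)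
    have "perfect_pairing (2 ^ K) p"
    proof (rule perfect_pairingI)
      show "fst (p j) < 2 ^ K \<and> snd (p j) < 2 ^ K" if "j < 2 ^ K div 2" for j
        using gA[OF that] by (auto simp: p_def A_def flip_lt)
      show "even ((2::nat) ^ K)" using i by simp
      show "inj_on (\<lambda>(j, b). if b then snd (p j) else fst (p j)) ({..<2 ^ K div 2} \<times> UNIV)"
      proof (rule inj_onI, clarify)
        fix j b j' b'
        assume j: "j < 2 ^ K div 2" "j' < 2 ^ K div 2"
          and eq: "(if b then snd (p j) else fst (p j)) = (if b' then snd (p j') else fst (p j'))"
        have "\<not> bit (g j) i" "\<not> bit (g j') i" using gA j by (auto simp: A_def)
        then have bb: "b = b'" using arg_cong[OF eq, of "\<lambda>x. bit x i"]
          by (auto simp: p_def bitflip split: if_splits)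
        then have "g j = g j'" using eq by (auto simp: p_def split: if_splits) (metis flip2)
        then show "j = j' \<and> b = b'" using g j bb by (auto simp: cA bij_betw_def inj_on_def)
      qed
    qed
    then show ?thesis by (intro exI[of _ p]) (auto simp: p_def bitflip)
  qed
  then obtain P where P: "\<And>i. i < K \<Longrightarrow> perfect_pairing (2 ^ K) (P i) \<and>
     (\<forall>j<2 ^ K div 2. \<forall>b. (bit (fst (P i j)) b \<noteq> bit (snd (P i j)) b) \<longleftrightarrow> b = i)"
    by metis
  have "butterfly_pairing K (\<lambda>l. P (l - 1))"
    unfolding butterfly_pairing_def
  proof
    fix l assume "l \<in> {1..K}"
    then have "l - 1 < K" by auto
    from P[OF this] show "perfect_pairing (2 ^ K) (P (l - 1)) \<and> (\<forall>j<2 ^ K div 2. \<forall>b.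
      (bit (fst (P (l - 1) j)) b \<noteq> bit (snd (P (l - 1) j)) b) \<longleftrightarrow> b = l - 1)" .
  qed
  then show ?thesis by blast
qed

lemma mat_adjoint_index:
  "i < dim_col A \<Longrightarrow> j < dim_row A \<Longrightarrow> mat_adjoint A $$ (i, j) = conjugate (A $$ (j, i))"
  by (simp add: mat_adjoint_def mat_of_rows_index cols_nth)

lemma mat_adjoint_carrier:
  fixes A :: "complex mat"
  shows "A \<in> carrier_mat n m \<Longrightarrow> mat_adjoint A \<in> carrier_mat m n"
  by (auto simp: mat_adjoint_def)

lemma mat_adjoint_scalar:
  fixes A :: "complex mat"
  assumes A: "A \<in> carrier_mat n m" and v: "v \<in> carrier_vec n" and w: "w \<in> carrier_vec m"
  shows "(mat_adjoint A *\<^sub>v v) \<bullet>c w = v \<bullet>c (A *\<^sub>v w)"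
proof -
  have "(mat_adjoint A *\<^sub>v v) \<bullet>c w =
      (\<Sum>i<m. \<Sum>j<n. cnj (A $$ (j, i)) * vec_index v j * cnj (vec_index w i))"
    using A v w mat_adjoint_carrier[OF A]
    by (auto simp: scalar_prod_def mat_adjoint_index sum_distrib_right atLeast0LessThan intro!: sum.cong)
  also have "\<dots> = (\<Sum>j<n. \<Sum>i<m. cnj (A $$ (j, i)) * vec_index v j * cnj (vec_index w i))"
    by (rule sum.swap)
  also have "\<dots> = v \<bullet>c (A *\<^sub>v w)"
    using A v w
    by (auto simp: scalar_prod_def sum_distrib_left atLeast0LessThan mult_ac intro!: sum.cong)
  finally show ?thesis .
qed

lemma loss_real:
  assumes M: "preserving_observable n M" and \<psi>: "\<psi> \<in> carrier_vec (2 ^ n)"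
  shows "complex_of_real (loss n pr K M \<psi> c) =
    (let U = circuit n pr K c in ((mat_adjoint U * M * U) *\<^sub>v \<psi>) \<bullet>c \<psi>)"
proof -
  define U where "U = circuit n pr K c"
  have U: "U \<in> carrier_mat (2 ^ n) (2 ^ n)" by (simp add: U_def circuit_carrier)
  have Mc: "M \<in> carrier_mat (2 ^ n) (2 ^ n)" and Ms: "mat_adjoint M = M"
    using M by (auto simp: preserving_observable_def)
  define v where "v = U *\<^sub>v \<psi>"
  have v: "v \<in> carrier_vec (2 ^ n)" using U \<psi> by (simp add: v_def)
  have "(mat_adjoint U * M * U) *\<^sub>v \<psi> = mat_adjoint U *\<^sub>v (M *\<^sub>v v)"
    using U Mc \<psi> mat_adjoint_carrier[OF U] v
    by (simp add: v_def assoc_mult_mat_vec[of _ "2 ^ n" "2 ^ n" _ "2 ^ n"]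
        mult_carrier_mat[of _ "2 ^ n" "2 ^ n"])
  then have z: "((mat_adjoint U * M * U) *\<^sub>v \<psi>) \<bullet>c \<psi> = (M *\<^sub>v v) \<bullet>c v"
    using mat_adjoint_scalar[OF U _ \<psi>, of "M *\<^sub>v v"] Mc v by (simp add: v_def)
  have "(M *\<^sub>v v) \<bullet>c v = v \<bullet>c (M *\<^sub>v v)"
    using mat_adjoint_scalar[OF Mc v v] by (simp add: Ms)
  also have "\<dots> = cnj ((M *\<^sub>v v) \<bullet>c v)"
    using Mc v by (simp add: scalar_prod_def mult.commute)
  finally have "(M *\<^sub>v v) \<bullet>c v \<in> \<real>" by (simp add: Reals_cnj_iff)
  then show ?thesis by (simp add: loss_def Let_def flip: U_def) (simp add: z)
qed

end

theory Submission
  imports Defs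
begin

text \<open>
  All layers preserve the Hamming weight, so a layer acts on a state of weight \<open>k\<close>. An entry of the
  layer matrix in a column of weight \<open>k\<close> is, up to a global phase, a linear combination of products
  of exactly \<open>k\<close> factors \<open>cis (\<plusminus>\<theta>\<^sub>i)\<close> in the angles of the layer: an RBS gate on a pair with one
  excitation contributes one factor, on a pair with two excitations the constant
  \<open>cis \<theta>\<^sub>i * cis (- \<theta>\<^sub>i)\<close>. The loss is therefore the real part of a combination of products of exactly
  \<open>2 k\<close> such factors, and along a sign vector \<open>s\<close> it is a trigonometric polynomial in \<open>t\<close> with even
  frequencies \<open>2 (k - m)\<close>, \<open>0 \<le> m \<le> 2 k\<close>. On these the shift rule is exact, because
  \<open>2 (\<Sum>q. a\<^sub>q sin (2 m r\<^sub>q)) = 2 m\<close> for \<open>m \<le> k\<close>. So for every \<open>s\<close> the estimator of parameter \<open>j\<close> equals \<open>s\<^sub>j\<close>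
  times the derivative of the loss in direction \<open>s\<close>, and averaging over \<open>s\<close> leaves the partial
  derivative with respect to parameter \<open>j\<close>.
\<close>

section \<open>Trigonometric polynomials and the parallel shift rule\<close>

text \<open>The index \<open>d\<close> counts factors exactly instead of bounding a degree, since
  parity of frequencies is what the shift rule relies on. Zero belongs to every degree so that
  vanishing matrix entries fit anywhere, and an angle may occur in several factors.\<close>

inductive trig_poly :: "nat \<Rightarrow> nat \<Rightarrow> ((nat \<Rightarrow> real) \<Rightarrow> complex) \<Rightarrow> bool" for N where
  zero: "trig_poly N d (\<lambda>_. 0)"
| const: "trig_poly N 0 (\<lambda>_. z)"
| times_cis: "trig_poly N d f \<Longrightarrow> i < N \<Longrightarrow> e \<in> {-1, 1} \<Longrightarrow>
    trig_poly N (Suc d) (\<lambda>\<theta>. cis (e * \<theta> i) * f \<theta>)"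
| add: "trig_poly N d f \<Longrightarrow> trig_poly N d g \<Longrightarrow> trig_poly N d (\<lambda>\<theta>. f \<theta> + g \<theta>)"

lemma trig_poly_scale: "trig_poly N d f \<Longrightarrow> trig_poly N d (\<lambda>\<theta>. z * f \<theta>)"
proof (induction rule: trig_poly.induct)
  case (times_cis d f i e)
  from trig_poly.times_cis[OF this(4) this(2,3)] show ?case by (simp add: mult.left_commute)
qed (auto simp: distrib_left intro: trig_poly.intros)

lemma trig_poly_mult:
  assumes "trig_poly N d f" "trig_poly N e g"
  shows "trig_poly N (d + e) (\<lambda>\<theta>. f \<theta> * g \<theta>)"
  using assms(1)
proof (induction rule: trig_poly.induct)
  case (times_cis d f i \<epsilon>)
  from trig_poly.times_cis[OF this(4) this(2,3)] show ?case by (simp add: mult.assoc)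
qed (auto simp: distrib_right intro: trig_poly.intros trig_poly_scale assms(2))

lemma trig_poly_cnj: "trig_poly N d f \<Longrightarrow> trig_poly N d (\<lambda>\<theta>. cnj (f \<theta>))"
proof (induction rule: trig_poly.induct)
  case (times_cis d f i e)
  from trig_poly.times_cis[OF this(4) this(2), of "- e"] this(3) show ?case
    by (auto simp: cis_cnj)
qed (auto intro: trig_poly.intros)

lemma trig_poly_sum:
  "(\<And>x. x \<in> A \<Longrightarrow> trig_poly N d (f x)) \<Longrightarrow> trig_poly N d (\<lambda>\<theta>. \<Sum>x\<in>A. f x \<theta>)"
  by (induction A rule: infinite_finite_induct) (auto intro: trig_poly.intros)

lemma trig_poly_prod:
  "(\<And>x. x \<in> A \<Longrightarrow> trig_poly N (d x) (f x)) \<Longrightarrow>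
    trig_poly N (\<Sum>x\<in>A. d x) (\<lambda>\<theta>. \<Prod>x\<in>A. f x \<theta>)"
  by (induction A rule: infinite_finite_induct) (auto intro: trig_poly.const trig_poly_mult)

section \<open>Derivatives along a line and exactness of the shift rule\<close>

lemma has_vector_derivative_cis:
  "((\<lambda>t. cis (b * t)) has_vector_derivative b *\<^sub>R (\<i> * cis (b * x))) (at x within S)"
  unfolding has_vector_derivative_def
  by (auto intro!: derivative_eq_intros)

text \<open>Partial and directional derivatives go through one induction with the same witness
  \<open>D\<close>, which gives the chain rule along lines without a detour through total
  derivatives.\<close>

lemma trig_poly_gradient:
  assumes "trig_poly N d f"
  shows "\<exists>D. (\<forall>i<N. ((\<lambda>t. f (\<theta>(i := t))) has_vector_derivative D i) (at (\<theta> i))) \<and>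
     (\<forall>s. ((\<lambda>t. f (\<lambda>i. \<theta> i + t * s i)) has_vector_derivative (\<Sum>i<N. s i *\<^sub>R D i)) (at 0))"
  using assms
proof (induction rule: trig_poly.induct)
  case (zero d)
  show ?case by (intro exI[of _ "\<lambda>_. 0"]) simp
next
  case (const z)
  show ?case by (intro exI[of _ "\<lambda>_. 0"]) simp
next
  case (times_cis d f i e)
  then obtain D where
    D: "\<And>j. j < N \<Longrightarrow> ((\<lambda>t. f (\<theta>(j := t))) has_vector_derivative D j) (at (\<theta> j))" and
    S: "\<And>s. ((\<lambda>t. f (\<lambda>i. \<theta> i + t * s i)) has_vector_derivative (\<Sum>i<N. s i *\<^sub>R D i)) (at 0)"
    by blast
  define u where "u = cis (e * \<theta> i)"
  \<comment> \<open>Product rule: the second summand differentiates the new factor, which depends on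
    coordinate \<open>i\<close> only.\<close>
  define D' where "D' j = u * D j + (if j = i then e *\<^sub>R (\<i> * u) * f \<theta> else 0)" for j
  have "((\<lambda>t. cis (e * (\<theta>(j := t)) i) * f (\<theta>(j := t))) has_vector_derivative D' j) (at (\<theta> j))"
    if "j < N" for j
  proof (cases "j = i")
    case True
    show ?thesis
      using has_vector_derivative_mult[OF has_vector_derivative_cis[of e "\<theta> j"] D[OF that]]
      by (simp add: True D'_def u_def)
  next
    case False
    then show ?thesis
      using has_vector_derivative_mult_right[OF D[OF that], of u]
      by (simp add: D'_def u_def)
  qed
  moreover have "((\<lambda>t. cis (e * (\<theta> i + t * s i)) * f (\<lambda>i. \<theta> i + t * s i))
      has_vector_derivative (\<Sum>i<N. s i *\<^sub>R D' i)) (at 0)" for s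
  proof -
    have 1: "((\<lambda>t. u * cis (e * s i * t)) has_vector_derivative u * ((e * s i) *\<^sub>R \<i>)) (at 0)"
      using has_vector_derivative_mult_right[OF has_vector_derivative_cis[of "e * s i" 0], of u]
      by simp
    have "(\<Sum>j<N. s j *\<^sub>R D' j) = (\<Sum>j<N. u * (s j *\<^sub>R D j))
        + (\<Sum>j<N. if j = i then s i *\<^sub>R (e *\<^sub>R (\<i> * u) * f \<theta>) else 0)"
      unfolding sum.distrib[symmetric]
      by (intro sum.cong) (auto simp: D'_def algebra_simps)
    also have "\<dots> = u * (\<Sum>j<N. s j *\<^sub>R D j) + u * ((e * s i) *\<^sub>R \<i>) * f \<theta>"
      using \<open>i < N\<close> by (simp add: sum_distrib_left scaleR_conv_of_real algebra_simps)
    \<comment> \<open>The arguments \<open>e * s i * 0\<close> and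
      \<open>\<theta> i + 0 * s i\<close> reproduce the form that the product rule yields at
      \<open>t = 0\<close>.\<close>
    finally have "(\<Sum>i<N. s i *\<^sub>R D' i) =
        u * cis (e * s i * 0) * (\<Sum>j<N. s j *\<^sub>R D j)
        + u * ((e * s i) *\<^sub>R \<i>) * f (\<lambda>i. \<theta> i + 0 * s i)"
      by simp
    moreover have "cis (e * (\<theta> i + t * s i)) = u * cis (e * s i * t)" for t
      by (simp add: u_def cis_mult distrib_left mult_ac)
    ultimately show ?thesis
      using has_vector_derivative_mult[OF 1 S[of s]] by simp
  qed
  ultimately show ?case by blast
next
  case (add d f g)
  then obtain D E where
    "\<forall>i<N. ((\<lambda>t. f (\<theta>(i := t))) has_vector_derivative D i) (at (\<theta> i))"
    "\<forall>s. ((\<lambda>t. f (\<lambda>i. \<theta> i + t * s i)) has_vector_derivative (\<Sum>i<N. s i *\<^sub>R D i)) (at 0)"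
    "\<forall>i<N. ((\<lambda>t. g (\<theta>(i := t))) has_vector_derivative E i) (at (\<theta> i))"
    "\<forall>s. ((\<lambda>t. g (\<lambda>i. \<theta> i + t * s i)) has_vector_derivative (\<Sum>i<N. s i *\<^sub>R E i)) (at 0)"
    by blast
  then show ?case
    by (intro exI[of _ "\<lambda>i. D i + E i"])
       (simp add: scaleR_add_right sum.distrib has_vector_derivative_add del: fun_upd_apply)
qed

text \<open>Each of the \<open>d\<close> factors of a monomial contributes the frequency \<open>1\<close> or \<open>-1\<close> along a sign
  vector, so that the total frequency has the parity of \<open>d\<close>.\<close>

lemma trig_poly_along_signs:
  assumes "trig_poly N d f" and s: "\<And>i. i < N \<Longrightarrow> s i \<in> {-1, 1}"
  shows "\<exists>C. \<forall>t. f (\<lambda>i. \<theta> i + t * s i) = (\<Sum>m\<le>d. C m * cis ((real d - 2 * real m) * t))"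
  using assms(1)
proof (induction rule: trig_poly.induct)
  case (zero d)
  show ?case by (intro exI[of _ "\<lambda>_. 0"]) simp
next
  case (const z)
  show ?case by (intro exI[of _ "\<lambda>_. z"]) simp
next
  case (times_cis d f i e)
  then obtain C where
    C: "\<And>t. f (\<lambda>i. \<theta> i + t * s i) = (\<Sum>m\<le>d. C m * cis ((real d - 2 * real m) * t))"
    by blast
  define u where "u = cis (e * \<theta> i)"
  have exp: "cis (e * (\<theta> i + t * s i)) * f (\<lambda>i. \<theta> i + t * s i) =
      (\<Sum>m\<le>d. u * C m * cis ((real d - 2 * real m + e * s i) * t))" for t
  proof -
    have "cis (e * (\<theta> i + t * s i)) * cis ((real d - 2 * real m) * t) =
        u * cis ((real d - 2 * real m + e * s i) * t)" for m
      unfolding u_def cis_mult by (simp add: algebra_simps)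
    then show ?thesis
      unfolding C sum_distrib_left by (intro sum.cong refl) (metis mult.left_commute mult.assoc)
  qed
  have "e * s i = 1 \<or> e * s i = -1"
    using times_cis(3) s[OF times_cis(2)] by auto
  then show ?case
  proof
    assume es: "e * s i = 1"
    \<comment> \<open>\<open>d - 2 m + 1 = (d + 1) - 2 m\<close>: indices stay, and the new top
      coefficient is zero.\<close>
    show ?thesis
      by (rule exI[of _ "\<lambda>m. if m \<le> d then u * C m else 0"])
         (auto simp: exp es intro!: sum.cong arg_cong[of _ _ cis])
  next
    assume es: "e * s i = -1"
    \<comment> \<open>\<open>d - 2 m - 1 = (d + 1) - 2 (m + 1)\<close>: indices move up by one, and
      the coefficient at 0 is zero.\<close>
    show ?thesis
      by (rule exI[of _ "\<lambda>m. case m of 0 \<Rightarrow> 0 | Suc m \<Rightarrow> u * C m"])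
         (auto simp: exp es sum.atMost_Suc_shift simp del: sum.atMost_Suc
            intro!: sum.cong arg_cong[of _ _ cis])
  qed
next
  case (add d f g)
  then obtain C D where
    "\<forall>t. f (\<lambda>i. \<theta> i + t * s i) = (\<Sum>m\<le>d. C m * cis ((real d - 2 * real m) * t))"
    "\<forall>t. g (\<lambda>i. \<theta> i + t * s i) = (\<Sum>m\<le>d. D m * cis ((real d - 2 * real m) * t))"
    by blast
  then show ?case
    by (intro exI[of _ "\<lambda>m. C m + D m"]) (simp add: distrib_right sum.distrib)
qed

text \<open>The powers of \<open>cos\<close> make the Chebyshev recursion
  \<open>sin (2 (m + 2) r) = (4 cos\<^sup>2 r - 2) sin (2 (m + 1) r) - sin (2 m r)\<close> close up.\<close>

lemma shift_coefficients_sin_cos: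
  assumes "shift_coefficients k a r"
  shows "m + i \<le> k \<Longrightarrow> (\<Sum>q=1..k. a q * (sin (2 * real m * r q) * cos (r q) ^ (2 * i))) = real m"
proof (induction m arbitrary: i rule: induct_nat_012)
  case 0
  then show ?case by simp
next
  case 1
  then have "Suc i \<in> {1..k}" by simp
  \<comment> \<open>The hypothesis at index \<open>Suc i\<close> has exponent
    \<open>2 i + 1\<close>; the odd cosine comes from
    \<open>sin (2 r) = 2 sin r cos r\<close>.\<close>
  then have "(\<Sum>q=1..k. a q * sin (r q) * cos (r q) ^ (2 * Suc i - 1)) = 1 / 2"
    using assms unfolding shift_coefficients_def by blast
  moreover have "(\<Sum>q=1..k. a q * (sin (2 * real (Suc 0) * r q) * cos (r q) ^ (2 * i))) =
      2 * (\<Sum>q=1..k. a q * sin (r q) * cos (r q) ^ (2 * Suc i - 1))"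
    unfolding sum_distrib_left by (intro sum.cong refl) (simp add: sin_double)
  ultimately show ?case by simp
next
  case (ge2 m)
  have rec: "sin (2 * real (Suc (Suc m)) * x) =
      (4 * cos x ^ 2 - 2) * sin (2 * real (Suc m) * x) - sin (2 * real m * x)" for x
  proof -
    define y where "y = 2 * real (Suc m) * x"
    have y: "2 * real (Suc (Suc m)) * x = y + 2 * x" "2 * real m * x = y - 2 * x"
      by (simp_all add: y_def algebra_simps)
    have "sin (y + 2 * x) = 2 * cos (2 * x) * sin y - sin (y - 2 * x)"
      by (simp add: sin_add sin_diff)
    then show ?thesis
      unfolding y y_def[symmetric] by (simp add: cos_double_cos)
  qed
  have expand: "b * (((4 * c\<^sup>2 - 2) * u - v) * c ^ (2 * i)) =
      4 * (b * (u * c ^ (2 * Suc i))) - 2 * (b * (u * c ^ (2 * i))) - b * (v * c ^ (2 * i))"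
    for b c u v :: real
    by (simp add: algebra_simps power2_eq_square)
  have "(\<Sum>q=1..k. a q * (sin (2 * real (Suc (Suc m)) * r q) * cos (r q) ^ (2 * i))) =
      4 * (\<Sum>q=1..k. a q * (sin (2 * real (Suc m) * r q) * cos (r q) ^ (2 * Suc i)))
      - 2 * (\<Sum>q=1..k. a q * (sin (2 * real (Suc m) * r q) * cos (r q) ^ (2 * i)))
      - (\<Sum>q=1..k. a q * (sin (2 * real m * r q) * cos (r q) ^ (2 * i)))"
    unfolding sum_distrib_left sum_subtractf[symmetric] rec expand ..
  also have "\<dots> = 4 * real (Suc m) - 2 * real (Suc m) - real m"
  proof -
    \<comment> \<open>Raising \<open>i\<close> by one is paid for by lowering \<open>m\<close>, so
      all three sums stay within the bound of the induction hypothesis.\<close>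
    have "Suc m + Suc i \<le> k" "Suc m + i \<le> k" "m + i \<le> k"
      using ge2.prems by simp_all
    then show ?thesis by (simp only: ge2.IH)
  qed
  finally show ?case by simp
qed

text \<open>Covers the frequencies of both signs; the negative ones follow because sine is
  odd.\<close>

lemma shift_coefficients_sin:
  assumes "shift_coefficients k a r" "m \<le> 2 * k"
  shows "(\<Sum>q=1..k. a q * sin (2 * (real k - real m) * r q)) = real k - real m"
proof (cases "m \<le> k")
  case True
  then show ?thesis
    using shift_coefficients_sin_cos[OF assms(1), of "k - m" 0] by (simp add: of_nat_diff)
next
  case False
  then have "real k - real m = - real (m - k)" by (simp add: of_nat_diff)
  then show ?thesis
    using shift_coefficients_sin_cos[OF assms(1), of "m - k" 0] assms(2)
    by (simp add: sum_negf del: minus_diff_eq)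
qed

text \<open>A mode \<open>cis (w t)\<close> contributes \<open>\<i> w\<close> to the derivative at 0
  and \<open>2 \<i> (\<Sum>q. a q * sin (w * r q))\<close> to the shift sum. For
  \<open>w = 2 (k - m)\<close> these agree, so the rule is exact for each single sign vector, before
  any averaging.\<close>

lemma shift_rule_exact:
  assumes tp: "trig_poly N (2 * k) f" and s: "\<And>i. i < N \<Longrightarrow> s i \<in> {-1, 1}"
    and ar: "shift_coefficients k a r"
    and der: "((\<lambda>t. f (\<lambda>i. \<theta> i + t * s i)) has_vector_derivative D) (at 0)"
  shows "(\<Sum>q=1..k. a q *\<^sub>R (f (\<lambda>i. \<theta> i + r q * s i) - f (\<lambda>i. \<theta> i + - (r q * s i)))) = D"
proof -
  obtain C where C: "\<And>t. f (\<lambda>i. \<theta> i + t * s i) =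
      (\<Sum>m\<le>2 * k. C m * cis ((real (2 * k) - 2 * real m) * t))"
    using trig_poly_along_signs[OF tp, of s \<theta>] s by blast
  let ?w = "\<lambda>m. 2 * (real k - real m)"
  have C: "f (\<lambda>i. \<theta> i + t * s i) = (\<Sum>m\<le>2 * k. C m * cis (?w m * t))" for t
    by (simp add: C algebra_simps)
  have "((\<lambda>t. f (\<lambda>i. \<theta> i + t * s i)) has_vector_derivative
      (\<Sum>m\<le>2 * k. C m * (?w m *\<^sub>R (\<i> * cis (?w m * 0))))) (at 0)"
    unfolding C
    by (intro has_vector_derivative_sum has_vector_derivative_mult_right has_vector_derivative_cis)
  with der have D: "D = (\<Sum>m\<le>2 * k. C m * (?w m *\<^sub>R \<i>))"
    using vector_derivative_unique_at by fastforce
  have diff: "f (\<lambda>i. \<theta> i + r q * s i) - f (\<lambda>i. \<theta> i + - (r q * s i)) =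
      (\<Sum>m\<le>2 * k. C m * (2 * \<i> * of_real (sin (?w m * r q))))" for q
  proof -
    have "cis x - cis (- x) = 2 * \<i> * of_real (sin x)" for x
      by (simp add: complex_eq_iff)
    then have "C m * cis (?w m * r q) - C m * cis (?w m * - r q) =
        C m * (2 * \<i> * of_real (sin (?w m * r q)))" for m
      by (metis mult_minus_right right_diff_distrib)
    then show ?thesis
      using C[of "r q"] C[of "- r q"] by (simp add: sum_subtractf[symmetric])
  qed
  have "(\<Sum>q=1..k. a q *\<^sub>R (f (\<lambda>i. \<theta> i + r q * s i) - f (\<lambda>i. \<theta> i + - (r q * s i)))) =
      (\<Sum>q=1..k. \<Sum>m\<le>2 * k. C m * (2 * \<i> * of_real (a q * sin (?w m * r q))))"
    unfolding diff scaleR_sum_right scaleR_conv_of_real of_real_mult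
    by (simp only: sum_distrib_left mult_ac)
  also have "\<dots> = (\<Sum>m\<le>2 * k. C m * (2 * \<i> * of_real (\<Sum>q=1..k. a q * sin (?w m * r q))))"
    unfolding of_real_sum sum_distrib_left by (rule sum.swap)
  also have "\<dots> = D"
    unfolding D
  proof (intro sum.cong refl)
    fix m assume "m \<in> {..2 * k}"
    then have "(\<Sum>q=1..k. a q * sin (?w m * r q)) = real k - real m"
      by (intro shift_coefficients_sin[OF ar]) simp
    then show "C m * (2 * \<i> * of_real (\<Sum>q=1..k. a q * sin (?w m * r q))) =
        C m * (?w m *\<^sub>R \<i>)"
      by (simp only: scaleR_conv_of_real of_real_mult) simp
  qed
  finally show ?thesis .
qed

section \<open>Averaging over uniform sign vectors\<close>

lemma finite_sign_vectors: "finite (sign_vectors m)"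
  and sign_vectors_nonempty: "sign_vectors m \<noteq> {}"
  by (auto simp: sign_vectors_def PiE_eq_empty_iff intro!: finite_PiE)

text \<open>Orthogonality of the coordinates: for \<open>i \<noteq> j\<close>, negating coordinate
  \<open>i\<close> permutes the sign vectors and changes the sign of the product.\<close>

lemma sum_sign_vectors_mult:
  assumes "i < m" "j < m"
  shows "(\<Sum>s\<in>sign_vectors m. s i * s j) = (if i = j then real (card (sign_vectors m)) else 0)"
proof (cases "i = j")
  case True
  have "s i * s i = 1" if "s \<in> sign_vectors m" for s
    using that assms by (auto simp: sign_vectors_def dest!: PiE_mem[of _ _ _ i])
  then show ?thesis using True by simp
next
  case False
  define flip where "flip s = s(i := - s i)" for s :: "nat \<Rightarrow> real"
  have "flip s \<in> sign_vectors m" if "s \<in> sign_vectors m" for s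
    using that assms unfolding sign_vectors_def flip_def
    by (auto simp: PiE_iff extensional_def)
  then have "bij_betw flip (sign_vectors m) (sign_vectors m)"
    by (intro bij_betwI[of _ _ _ flip]) (auto simp: flip_def)
  then have "(\<Sum>s\<in>sign_vectors m. s i * s j) = (\<Sum>s\<in>sign_vectors m. flip s i * flip s j)"
    by (rule sum.reindex_bij_betw[symmetric])
  also have "\<dots> = - (\<Sum>s\<in>sign_vectors m. s i * s j)"
    using False by (simp add: flip_def sum_negf)
  finally show ?thesis using False by simp
qed

text \<open>By orthogonality the factor \<open>s j\<close> extracts the \<open>j\<close>-th partial
  derivative from the directional derivative.\<close>

lemma expectation_sign_vectors:
  assumes "j < m"
  shows "measure_pmf.expectation (pmf_of_set (sign_vectors m)) (\<lambda>s. s j * (\<Sum>i<m. s i * D i)) = D j"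
proof -
  have "(\<Sum>s\<in>sign_vectors m. s j * (\<Sum>i<m. s i * D i)) =
      (\<Sum>i<m. (\<Sum>s\<in>sign_vectors m. s i * s j) * D i)"
    unfolding sum_distrib_left sum_distrib_right
    by (subst sum.swap) (simp add: mult_ac)
  also have "\<dots> = (\<Sum>i<m. if i = j then real (card (sign_vectors m)) * D i else 0)"
    using assms by (intro sum.cong) (auto simp: sum_sign_vectors_mult)
  also have "\<dots> = real (card (sign_vectors m)) * D j"
    using assms by simp
  finally show ?thesis
    by (simp add: integral_pmf_of_set finite_sign_vectors sign_vectors_nonempty)
qed

lemma parallel_shift_unbiased:
  assumes tp: "trig_poly N (2 * k) F" and ar: "shift_coefficients k a r" and j: "j < N"
  shows "((\<lambda>t. Re (F (\<theta>(j := t)))) has_real_derivative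
     measure_pmf.expectation (pmf_of_set (sign_vectors N)) (\<lambda>s. s j * (\<Sum>q=1..k. a q *
       (Re (F (\<lambda>i. \<theta> i + r q * s i)) - Re (F (\<lambda>i. \<theta> i + - (r q * s i))))))) (at (\<theta> j))"
proof -
  obtain D where
    D: "\<And>i. i < N \<Longrightarrow> ((\<lambda>t. F (\<theta>(i := t))) has_vector_derivative D i) (at (\<theta> i))" and
    S: "\<And>s. ((\<lambda>t. F (\<lambda>i. \<theta> i + t * s i)) has_vector_derivative (\<Sum>i<N. s i *\<^sub>R D i)) (at 0)"
    using trig_poly_gradient[OF tp, of \<theta>] by blast
  have "(\<Sum>q=1..k. a q * (Re (F (\<lambda>i. \<theta> i + r q * s i)) - Re (F (\<lambda>i. \<theta> i + - (r q * s i))))) =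
      (\<Sum>i<N. s i * Re (D i))" if "s \<in> sign_vectors N" for s
  proof -
    have "s i \<in> {-1, 1}" if "i < N" for i
      using \<open>s \<in> _\<close> that by (auto simp: sign_vectors_def dest!: PiE_mem[of _ _ _ i])
    from arg_cong[where f = Re, OF shift_rule_exact[OF tp this ar S]] show ?thesis by simp
  qed
  \<comment> \<open>The shift rule is exact only where all signs are 1 or -1, so the integrands are
    compared on the support of the distribution.\<close>
  then have "measure_pmf.expectation (pmf_of_set (sign_vectors N)) (\<lambda>s. s j * (\<Sum>q=1..k. a q *
       (Re (F (\<lambda>i. \<theta> i + r q * s i)) - Re (F (\<lambda>i. \<theta> i + - (r q * s i)))))) =
     measure_pmf.expectation (pmf_of_set (sign_vectors N)) (\<lambda>s. s j * (\<Sum>i<N. s i * Re (D i)))"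
    by (intro integral_cong_AE)
       (auto simp: AE_measure_pmf_iff finite_sign_vectors sign_vectors_nonempty)
  also have "\<dots> = Re (D j)" by (rule expectation_sign_vectors[OF j])
  finally show ?thesis
    using bounded_linear.has_vector_derivative[OF bounded_linear_Re D[OF j]]
    by (simp add: has_real_derivative_iff_has_vector_derivative)
qed

section \<open>Weight preservation and the entries of the layers\<close>

lemma hamming_weight_sum: "hamming_weight n x = (\<Sum>i<n. qbit x i)"
proof -
  have "{i. i < n \<and> bit x i} = {..<n} \<inter> {i. bit x i}" by auto
  then show ?thesis by (simp add: hamming_weight_def qbit_def)
qed

text \<open>A perfect pairing is a bijection from gate legs to qubits, so the sum over qubits can be
  regrouped by gates.\<close>

lemma hamming_weight_pairing:
  assumes "perfect_pairing n p"
  shows "hamming_weight n x = (\<Sum>j<n div 2. qbit x (fst (p j)) + qbit x (snd (p j)))"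
proof -
  have "hamming_weight n x = (\<Sum>jb\<in>{..<n div 2} \<times> UNIV.
      qbit x ((\<lambda>(j, b). if b then snd (p j) else fst (p j)) jb))"
    unfolding hamming_weight_sum
    by (rule sum.reindex_bij_betw[OF assms[unfolded perfect_pairing_def], symmetric])
  also have "\<dots> = (\<Sum>j<n div 2. \<Sum>b\<in>UNIV. qbit x (if b then snd (p j) else fst (p j)))"
    by (simp add: sum.cartesian_product case_prod_unfold)
  finally show ?thesis by (simp add: UNIV_bool add.commute)
qed

lemma qbit_cases: "qbit x i = 0 \<or> qbit x i = 1"
  by (auto simp: qbit_def)

lemma RBS_index_nonzero:
  assumes "RBS t $$ (2 * qbit x i + qbit x i', 2 * qbit y j + qbit y j') \<noteq> 0"
  shows "qbit x i + qbit x i' = qbit y j + qbit y j'"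
  using assms qbit_cases[of x i] qbit_cases[of x i'] qbit_cases[of y j] qbit_cases[of y j']
  by (elim disjE) (simp_all add: RBS_def mat_of_rows_list_def)

lemma Rz_index_nonzero: "Rz t $$ (qbit x i, qbit y j) \<noteq> 0 \<Longrightarrow> qbit x i = qbit y j"
  using qbit_cases[of x i] qbit_cases[of y j]
  by (elim disjE) (simp_all add: Rz_def mat_of_rows_list_def)

text \<open>A nonzero product has no zero factor, so every gate keeps the number of excitations of
  its own pair; summing over the pairs gives the weight.\<close>

lemma RBS_layer_index_nonzero:
  assumes "perfect_pairing n p" "x < 2 ^ n" "y < 2 ^ n" "RBS_layer n p \<theta> $$ (x, y) \<noteq> 0"
  shows "hamming_weight n x = hamming_weight n y"
  unfolding hamming_weight_pairing[OF assms(1)]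
proof (intro sum.cong refl)
  fix j assume "j \<in> {..<n div 2}"
  then have "RBS (\<theta> j) $$ (2 * qbit x (fst (p j)) + qbit x (snd (p j)),
                   2 * qbit y (fst (p j)) + qbit y (snd (p j))) \<noteq> 0"
    using assms(2-4) by (auto simp: RBS_layer_def)
  then show "qbit x (fst (p j)) + qbit x (snd (p j)) = qbit y (fst (p j)) + qbit y (snd (p j))"
    by (rule RBS_index_nonzero)
qed

lemma Rz_layer_index_nonzero:
  assumes "x < 2 ^ n" "y < 2 ^ n" "Rz_layer n \<phi> $$ (x, y) \<noteq> 0"
  shows "hamming_weight n x = hamming_weight n y"
  unfolding hamming_weight_sum
proof (intro sum.cong refl)
  fix i assume "i \<in> {..<n}"
  then have "Rz (\<phi> i) $$ (qbit x i, qbit y i) \<noteq> 0"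
    using assms by (auto simp: Rz_layer_def)
  then show "qbit x i = qbit y i" by (rule Rz_index_nonzero)
qed

section \<open>Matrix entries of the layers as trigonometric polynomials\<close>

lemma trig_poly_cis: "i < N \<Longrightarrow> trig_poly N (Suc 0) (\<lambda>\<theta>. z * cis (\<theta> i))"
  using trig_poly_scale[OF trig_poly.times_cis[OF trig_poly.const[of N 1], of i 1]] by simp

lemma trig_poly_cis': "i < N \<Longrightarrow> trig_poly N (Suc 0) (\<lambda>\<theta>. z * cis (- \<theta> i))"
  using trig_poly_scale[OF trig_poly.times_cis[OF trig_poly.const[of N 1], of i "-1"]] by simp

text \<open>\<open>cis t * cis (- t) = 1\<close> lifts a constant to degree 2, the degree required
  of the RBS entry for a doubly occupied pair.\<close>

lemma trig_poly_two_const: "i < N \<Longrightarrow> trig_poly N 2 (\<lambda>_. z)"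
  using trig_poly_mult[OF trig_poly_cis[of i N z] trig_poly_cis'[of i N 1]]
  by (simp add: mult.assoc cis_mult numeral_2_eq_2)

lemma trig_poly_cos: "i < N \<Longrightarrow> trig_poly N (Suc 0) (\<lambda>\<theta>. complex_of_real (cos (\<theta> i)))"
proof -
  assume i: "i < N"
  have "complex_of_real (cos t) = 1 / 2 * cis t + 1 / 2 * cis (- t)" for t
    by (simp add: complex_eq_iff)
  then show ?thesis
    using trig_poly.add[OF trig_poly_cis[OF i, of "1 / 2"] trig_poly_cis'[OF i, of "1 / 2"]]
    by simp
qed

lemma trig_poly_sin: "i < N \<Longrightarrow> trig_poly N (Suc 0) (\<lambda>\<theta>. complex_of_real (sin (\<theta> i)))"
proof -
  assume i: "i < N"
  have "complex_of_real (sin t) = - \<i> / 2 * cis t + \<i> / 2 * cis (- t)" for t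
    by (simp add: complex_eq_iff)
  then show ?thesis
    using trig_poly.add[OF trig_poly_cis[OF i, of "- \<i> / 2"] trig_poly_cis'[OF i, of "\<i> / 2"]]
    by simp
qed

text \<open>The degree depends on the column alone: it is the number of excitations entering the
  gate. Entries between different excitation numbers vanish and fit any degree.\<close>

lemma trig_poly_RBS_index:
  assumes "j < N"
  shows "trig_poly N (qbit y i + qbit y i')
    (\<lambda>\<theta>. RBS (\<theta> j) $$ (2 * qbit x f + qbit x f', 2 * qbit y i + qbit y i'))"
  using qbit_cases[of x f] qbit_cases[of x f'] qbit_cases[of y i] qbit_cases[of y i']
    trig_poly.zero trig_poly.const trig_poly_cos[OF assms] trig_poly_sin[OF assms]
    trig_poly_two_const[OF assms] trig_poly_scale[OF trig_poly_sin[OF assms], of "-1"]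
  by (elim disjE) (simp_all add: RBS_def mat_of_rows_list_def numeral_2_eq_2)

lemma trig_poly_RBS_layer_index:
  assumes "perfect_pairing n p" "x < 2 ^ n" "y < 2 ^ n"
  shows "trig_poly (n div 2) (hamming_weight n y) (\<lambda>\<theta>. RBS_layer n p \<theta> $$ (x, y))"
proof -
  have "trig_poly (n div 2) (hamming_weight n y) (\<lambda>\<theta>. \<Prod>j<n div 2.
     RBS (\<theta> j) $$ (2 * qbit x (fst (p j)) + qbit x (snd (p j)),
                   2 * qbit y (fst (p j)) + qbit y (snd (p j))))"
    unfolding hamming_weight_pairing[OF assms(1)]
    by (intro trig_poly_prod trig_poly_RBS_index) simp
  then show ?thesis using assms(2,3) by (simp add: RBS_layer_def)
qed

text \<open>The half angles of the \<open>R\<^sub>z\<close> gates only enter through a global phase.\<close>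

lemma trig_poly_Rz_layer_index:
  assumes "x < 2 ^ n" "y < 2 ^ n"
  shows "\<exists>w. trig_poly n (hamming_weight n y) w \<and>
    (\<forall>\<phi>. Rz_layer n \<phi> $$ (x, y) = cis (\<Sum>i<n. \<phi> i / 2) * w \<phi>)"
proof -
  \<comment> \<open>With \<open>cis (\<phi> i / 2)\<close> pulled out, the diagonal of the gate
    becomes 1 and \<open>cis (- \<phi> i)\<close>, of degree 0 and 1.\<close>
  define w where "w i \<phi> = (if qbit x i = qbit y i then if qbit y i = 0 then 1 else 1 * cis (- \<phi> i) else 0)"
    for i and \<phi> :: "nat \<Rightarrow> real"
  have w: "trig_poly n (qbit y i) (w i)" if "i < n" for i
    using qbit_cases[of x i] qbit_cases[of y i] trig_poly_cis'[OF that, of 1]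
    by (elim disjE) (simp_all add: w_def[abs_def] trig_poly.const trig_poly.zero)
  have "Rz t $$ (qbit x i, qbit y i) = cis (t / 2) * w i \<phi>" if "t = \<phi> i" for i t \<phi>
    using qbit_cases[of x i] qbit_cases[of y i] that
    by (elim disjE) (auto simp: Rz_def mat_of_rows_list_def w_def cis_mult)
  then have "Rz_layer n \<phi> $$ (x, y) = (\<Prod>i<n. cis (\<phi> i / 2)) * (\<Prod>i<n. w i \<phi>)" for \<phi>
    using assms by (simp add: Rz_layer_def prod.distrib)
  moreover have "(\<Prod>i<n. cis (\<phi> i / 2)) = cis (\<Sum>i<n. \<phi> i / 2)" for \<phi> :: "nat \<Rightarrow> real"
    by (induction n) (simp_all add: cis_mult)
  moreover have "trig_poly n (hamming_weight n y) (\<lambda>\<phi>. \<Prod>i<n. w i \<phi>)"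
    unfolding hamming_weight_sum by (intro trig_poly_prod w) simp
  ultimately show ?thesis
    by (intro exI[of _ "\<lambda>\<phi>. \<Prod>i<n. w i \<phi>"]) simp
qed

text \<open>Coordinate form of lying in \<open>weight_subspace\<close>, which combines directly with
  the zero pattern of the layer matrices.\<close>

definition weight_supported :: "nat \<Rightarrow> nat \<Rightarrow> complex Matrix.vec \<Rightarrow> bool" where
  "weight_supported n k v \<longleftrightarrow> v \<in> carrier_vec (2 ^ n) \<and>
     (\<forall>x<2 ^ n. hamming_weight n x \<noteq> k \<longrightarrow> vec_index v x = 0)"

lemma mult_mat_vec_sum:
  "A \<in> carrier_mat m m \<Longrightarrow> v \<in> carrier_vec m \<Longrightarrow> x < m \<Longrightarrow>
    vec_index (A *\<^sub>v v) x = (\<Sum>y<m. A $$ (x, y) * vec_index v y)"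
  by (auto simp: scalar_prod_def atLeast0LessThan intro!: sum.cong)

lemma weight_supported_mult:
  assumes A: "A \<in> carrier_mat (2 ^ n) (2 ^ n)" and v: "weight_supported n k v"
    and "\<And>x y. x < 2 ^ n \<Longrightarrow> y < 2 ^ n \<Longrightarrow> A $$ (x, y) \<noteq> 0 \<Longrightarrow>
      hamming_weight n x = hamming_weight n y"
  shows "weight_supported n k (A *\<^sub>v v)"
  unfolding weight_supported_def
proof (intro conjI allI impI)
  have vc: "v \<in> carrier_vec (2 ^ n)" using v by (simp add: weight_supported_def)
  show "A *\<^sub>v v \<in> carrier_vec (2 ^ n)" using A vc by simp
  fix x assume x: "x < 2 ^ n" "hamming_weight n x \<noteq> k"
  have "A $$ (x, y) * vec_index v y = 0" if "y < 2 ^ n" for y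
    using assms(3)[OF x(1) that] x(2) v that by (auto simp: weight_supported_def)
  then show "vec_index (A *\<^sub>v v) x = 0"
    unfolding mult_mat_vec_sum[OF A vc x(1)] by (intro sum.neutral) simp
qed

lemma RBS_layer_carrier: "RBS_layer n p \<theta> \<in> carrier_mat (2 ^ n) (2 ^ n)"
  and Rz_layer_carrier: "Rz_layer n \<phi> \<in> carrier_mat (2 ^ n) (2 ^ n)"
  by (simp_all add: RBS_layer_def Rz_layer_def)

lemma weight_supported_Rz_layer:
  "weight_supported n k v \<Longrightarrow> weight_supported n k (Rz_layer n \<phi> *\<^sub>v v)"
  by (rule weight_supported_mult[OF Rz_layer_carrier]) (auto intro: Rz_layer_index_nonzero)

lemma weight_supported_RBS_layer:
  "perfect_pairing n p \<Longrightarrow> weight_supported n k v \<Longrightarrow> weight_supported n k (RBS_layer n p \<theta> *\<^sub>v v)"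
  by (rule weight_supported_mult[OF RBS_layer_carrier]) (auto intro: RBS_layer_index_nonzero)

text \<open>Applied with \<open>L = l - 1\<close>, this describes the state that enters layer
  \<open>l\<close>.\<close>

lemma weight_supported_circuit:
  assumes "weight_supported n k \<psi>" "\<And>l. l \<in> {1..L} \<Longrightarrow> perfect_pairing n (pr l)"
  shows "weight_supported n k (circuit n pr L c *\<^sub>v \<psi>)"
  using assms(2)
proof (induction L)
  case 0
  then show ?case using assms(1) by (simp add: weight_supported_def)
next
  case (Suc L)
  have "circuit n pr (Suc L) c *\<^sub>v \<psi> = RBS_layer n (pr (Suc L)) (fst c (Suc L)) *\<^sub>v
      (Rz_layer n (snd c (Suc L)) *\<^sub>v (circuit n pr L c *\<^sub>v \<psi>))"
    using assms(1) RBS_layer_carrier Rz_layer_carrier circuit_carrier[of n pr L c]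
    by (simp add: weight_supported_def assoc_mult_mat_vec[of _ "2 ^ n" "2 ^ n" _ "2 ^ n"]
        mult_carrier_mat[of _ "2 ^ n" "2 ^ n"])
  then show ?case
    using Suc by (simp add: weight_supported_Rz_layer weight_supported_RBS_layer)
qed

lemma weight_supported_weight_subspace:
  assumes "\<psi> \<in> weight_subspace n k"
  shows "weight_supported n k \<psi>"
proof -
  interpret vec_space "TYPE(complex)" "2 ^ n" .
  let ?S = "{unit_vec (2 ^ n) x | x. x < 2 ^ n \<and> hamming_weight n x = k} :: complex Matrix.vec set"
  obtain A a where A: "finite A" "A \<subseteq> ?S" "\<psi> = lincomb a A"
    using assms unfolding weight_subspace_def span_def by auto
  have Ac: "A \<subseteq> carrier_vec (2 ^ n)" using A(2) by auto
  have "vec_index \<psi> x = 0" if x: "x < 2 ^ n" "hamming_weight n x \<noteq> k" for x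
  proof -
    have "vec_index v x = 0" if "v \<in> A" for v
      using A(2) that x by auto
    then show ?thesis
      unfolding A(3) lincomb_index[OF x(1) Ac] by simp
  qed
  moreover have "\<psi> \<in> carrier_vec (2 ^ n)"
    using A Ac by (auto intro: lincomb_closed)
  ultimately show ?thesis by (simp add: weight_supported_def)
qed

section \<open>Isolating one layer of the circuit\<close>

lemma circuit_cong:
  assumes "\<And>l. l \<in> {1..L} \<Longrightarrow> fst c l = fst c' l \<and> snd c l = snd c' l"
  shows "circuit n pr L c = circuit n pr L c'"
  using assms by (induction L) auto

text \<open>\<open>A\<close> is the product of the layers after \<open>l\<close>. It is chosen
  before \<open>c'\<close>, so it is constant while the angles of layer \<open>l\<close>
  vary.\<close>

lemma circuit_split:
  assumes "l \<in> {1..K}"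
  shows "\<exists>A\<in>carrier_mat (2 ^ n) (2 ^ n). \<forall>c'.
    (\<forall>m. m \<noteq> l \<longrightarrow> fst c' m = fst c m \<and> snd c' m = snd c m) \<longrightarrow>
    circuit n pr K c' =
      A * ((RBS_layer n (pr l) (fst c' l) * Rz_layer n (snd c' l)) * circuit n pr (l - 1) c)"
  using assms
proof (induction K)
  case 0
  then show ?case by simp
next
  case (Suc K)
  let ?G = "\<lambda>c l. RBS_layer n (pr l) (fst c l) * Rz_layer n (snd c l)"
  have G: "?G c l \<in> carrier_mat (2 ^ n) (2 ^ n)" for c l
    using RBS_layer_carrier Rz_layer_carrier by (rule mult_carrier_mat)
  show ?case
  proof (cases "l = Suc K")
    case True
    have "circuit n pr (Suc K) c' = 1\<^sub>m (2 ^ n) * (?G c' l * circuit n pr (l - 1) c)"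
      if "\<forall>m. m \<noteq> l \<longrightarrow> fst c' m = fst c m \<and> snd c' m = snd c m" for c'
    proof -
      have "circuit n pr K c' = circuit n pr K c"
        using that True by (intro circuit_cong) auto
      then show ?thesis
        using True left_mult_one_mat[OF mult_carrier_mat[OF G circuit_carrier]] by simp
    qed
    then show ?thesis by (intro bexI[of _ "1\<^sub>m (2 ^ n)"]) auto
  next
    case False
    with Suc obtain A where A: "A \<in> carrier_mat (2 ^ n) (2 ^ n)" and
      eq: "\<And>c'. (\<forall>m. m \<noteq> l \<longrightarrow> fst c' m = fst c m \<and> snd c' m = snd c m) \<Longrightarrow>
        circuit n pr K c' = A * (?G c' l * circuit n pr (l - 1) c)"
      by (auto simp: le_Suc_eq)
    have "circuit n pr (Suc K) c' = (?G c (Suc K) * A) * (?G c' l * circuit n pr (l - 1) c)"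
      if c': "\<forall>m. m \<noteq> l \<longrightarrow> fst c' m = fst c m \<and> snd c' m = snd c m" for c'
    proof -
      have "?G c' (Suc K) = ?G c (Suc K)" using c' False by auto
      then show ?thesis
        using assoc_mult_mat[OF G A mult_carrier_mat[OF G circuit_carrier]]
        by (simp add: eq[OF c'])
    qed
    then show ?thesis using mult_carrier_mat[OF G A] by blast
  qed
qed

section \<open>State vectors with trigonometric polynomial entries up to a common phase\<close>

text \<open>The common factor \<open>g\<close> absorbs the half angles of an \<open>R_z\<close>
  layer, which have no integer frequencies; for an RBS layer it is 1.\<close>

definition phased_trig_poly :: "nat \<Rightarrow> nat \<Rightarrow> nat \<Rightarrow> ((nat \<Rightarrow> real) \<Rightarrow> complex) \<Rightarrow>
    ((nat \<Rightarrow> real) \<Rightarrow> complex Matrix.vec) \<Rightarrow> bool" where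
  "phased_trig_poly N k m g v \<longleftrightarrow> (\<forall>\<theta>. v \<theta> \<in> carrier_vec m) \<and>
     (\<forall>x<m. \<exists>w. trig_poly N k w \<and> (\<forall>\<theta>. vec_index (v \<theta>) x = g \<theta> * w \<theta>))"

lemma phased_trig_poly_mult:
  assumes A: "A \<in> carrier_mat m m" and v: "phased_trig_poly N k m g v"
  shows "phased_trig_poly N k m g (\<lambda>\<theta>. A *\<^sub>v v \<theta>)"
proof -
  have vc: "v \<theta> \<in> carrier_vec m" for \<theta> using v by (simp add: phased_trig_poly_def)
  obtain w where w: "\<And>x. x < m \<Longrightarrow> trig_poly N k (w x)"
    "\<And>x \<theta>. x < m \<Longrightarrow> vec_index (v \<theta>) x = g \<theta> * w x \<theta>"
    using v unfolding phased_trig_poly_def by metis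
  have "trig_poly N k (\<lambda>\<theta>. \<Sum>y<m. A $$ (x, y) * w y \<theta>)" for x
    by (intro trig_poly_sum trig_poly_scale w) simp
  moreover have "vec_index (A *\<^sub>v v \<theta>) x = g \<theta> * (\<Sum>y<m. A $$ (x, y) * w y \<theta>)" if "x < m" for x \<theta>
    unfolding mult_mat_vec_sum[OF A vc that] sum_distrib_left
    by (intro sum.cong) (auto simp: w)
  ultimately show ?thesis
    using A vc unfolding phased_trig_poly_def by (blast intro: mult_mat_vec_carrier)
qed

text \<open>The phases cancel because \<open>g * cnj g = 1\<close>. Conjugation keeps the degree, so
  the two degrees \<open>k\<close> add up to \<open>2 * k\<close>.\<close>

lemma phased_trig_poly_scalar_prod:
  assumes u: "phased_trig_poly N k m g u" and v: "phased_trig_poly N k m g v"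
    and g: "\<And>\<theta>. cmod (g \<theta>) = 1"
  shows "trig_poly N (2 * k) (\<lambda>\<theta>. u \<theta> \<bullet>c v \<theta>)"
proof -
  have c: "u \<theta> \<in> carrier_vec m" "v \<theta> \<in> carrier_vec m" for \<theta>
    using u v by (simp_all add: phased_trig_poly_def)
  obtain a where a: "\<And>x. x < m \<Longrightarrow> trig_poly N k (a x)"
    "\<And>x \<theta>. x < m \<Longrightarrow> vec_index (u \<theta>) x = g \<theta> * a x \<theta>"
    using u unfolding phased_trig_poly_def by metis
  obtain b where b: "\<And>x. x < m \<Longrightarrow> trig_poly N k (b x)"
    "\<And>x \<theta>. x < m \<Longrightarrow> vec_index (v \<theta>) x = g \<theta> * b x \<theta>"
    using v unfolding phased_trig_poly_def by metis
  have gg: "g \<theta> * cnj (g \<theta>) = 1" for \<theta>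
    using g[of \<theta>] by (simp add: complex_norm_square[symmetric])
  have "u \<theta> \<bullet>c v \<theta> = (\<Sum>x<m. a x \<theta> * cnj (b x \<theta>))" for \<theta>
  proof -
    have "u \<theta> \<bullet>c v \<theta> = (\<Sum>x<m. vec_index (u \<theta>) x * cnj (vec_index (v \<theta>) x))"
      using c[of \<theta>] by (auto simp: scalar_prod_def atLeast0LessThan intro!: sum.cong)
    also have "\<dots> = (\<Sum>x<m. (g \<theta> * cnj (g \<theta>)) * (a x \<theta> * cnj (b x \<theta>)))"
      by (intro sum.cong) (auto simp: a b)
    finally show ?thesis by (simp add: gg)
  qed
  moreover have "trig_poly N (2 * k) (\<lambda>\<theta>. \<Sum>x<m. a x \<theta> * cnj (b x \<theta>))"
    unfolding mult_2 by (intro trig_poly_sum trig_poly_mult trig_poly_cnj a b) simp_all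
  ultimately show ?thesis by simp
qed

text \<open>Moving the adjoint across the inner product leaves \<open>M U \<psi>\<close> against
  \<open>U \<psi>\<close>, two vectors with the same phase and degree.\<close>

lemma phased_trig_poly_expectation:
  assumes M: "M \<in> carrier_mat m m" and U: "\<And>\<theta>. U \<theta> \<in> carrier_mat m m"
    and \<psi>: "\<psi> \<in> carrier_vec m"
    and v: "phased_trig_poly N k m g (\<lambda>\<theta>. U \<theta> *\<^sub>v \<psi>)" and g: "\<And>\<theta>. cmod (g \<theta>) = 1"
  shows "trig_poly N (2 * k) (\<lambda>\<theta>. ((mat_adjoint (U \<theta>) * M * U \<theta>) *\<^sub>v \<psi>) \<bullet>c \<psi>)"
proof -
  have "((mat_adjoint (U \<theta>) * M * U \<theta>) *\<^sub>v \<psi>) \<bullet>c \<psi> = (M *\<^sub>v (U \<theta> *\<^sub>v \<psi>)) \<bullet>c (U \<theta> *\<^sub>v \<psi>)" for \<theta>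
  proof -
    have "(mat_adjoint (U \<theta>) * M * U \<theta>) *\<^sub>v \<psi> = mat_adjoint (U \<theta>) *\<^sub>v (M *\<^sub>v (U \<theta> *\<^sub>v \<psi>))"
      using U[of \<theta>] M \<psi> mat_adjoint_carrier[OF U[of \<theta>]]
      by (simp add: assoc_mult_mat_vec[of _ m m _ m] mult_carrier_mat[of _ m m])
    then show ?thesis
      using mat_adjoint_scalar[OF U _ \<psi>, of "M *\<^sub>v (U \<theta> *\<^sub>v \<psi>)" \<theta>] M U[of \<theta>] \<psi> by simp
  qed
  then show ?thesis
    using phased_trig_poly_scalar_prod[OF phased_trig_poly_mult[OF M v] v g] by simp
qed

text \<open>Columns of weight other than \<open>k\<close> meet zero entries of \<open>u\<close>, so
  only entries of degree exactly \<open>k\<close> survive.\<close>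

lemma phased_trig_poly_RBS_layer:
  assumes p: "perfect_pairing n p" and u: "weight_supported n k u"
  shows "phased_trig_poly (n div 2) k (2 ^ n) (\<lambda>_. 1) (\<lambda>\<theta>. RBS_layer n p \<theta> *\<^sub>v u)"
proof -
  have uc: "u \<in> carrier_vec (2 ^ n)" using u by (simp add: weight_supported_def)
  have "trig_poly (n div 2) k (\<lambda>\<theta>. vec_index (RBS_layer n p \<theta> *\<^sub>v u) x)" if x: "x < 2 ^ n" for x
    unfolding mult_mat_vec_sum[OF RBS_layer_carrier uc x]
  proof (rule trig_poly_sum)
    fix y :: nat assume "y \<in> {..<2 ^ n}"
    then have y: "y < 2 ^ n" by simp
    show "trig_poly (n div 2) k (\<lambda>\<theta>. RBS_layer n p \<theta> $$ (x, y) * vec_index u y)"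
    proof (cases "hamming_weight n y = k")
      case True
      then show ?thesis
        using trig_poly_scale[OF trig_poly_RBS_layer_index[OF p x y], of "vec_index u y"]
        by (simp add: mult.commute)
    next
      case False
      then show ?thesis using u y by (simp add: weight_supported_def trig_poly.zero)
    qed
  qed
  then show ?thesis
    using mult_mat_vec_carrier[OF RBS_layer_carrier uc] by (auto simp: phased_trig_poly_def)
qed

lemma phased_trig_poly_Rz_layer:
  assumes u: "weight_supported n k u"
  shows "phased_trig_poly n k (2 ^ n) (\<lambda>\<phi>. cis (\<Sum>i<n. \<phi> i / 2)) (\<lambda>\<phi>. Rz_layer n \<phi> *\<^sub>v u)"
proof -
  have uc: "u \<in> carrier_vec (2 ^ n)" using u by (simp add: weight_supported_def)
  \<comment> \<open>One witness per matrix entry, chosen as a function of \<open>x\<close> and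
    \<open>y\<close> so that a row can be summed over \<open>y\<close>.\<close>
  define w where "w x y = (SOME w. trig_poly n (hamming_weight n y) w \<and>
    (\<forall>\<phi>. Rz_layer n \<phi> $$ (x, y) = cis (\<Sum>i<n. \<phi> i / 2) * w \<phi>))" for x y
  have w: "trig_poly n (hamming_weight n y) (w x y)"
    "\<And>\<phi>. Rz_layer n \<phi> $$ (x, y) = cis (\<Sum>i<n. \<phi> i / 2) * w x y \<phi>"
    if "x < 2 ^ n" "y < 2 ^ n" for x y
    using someI_ex[OF trig_poly_Rz_layer_index[OF that]] unfolding w_def by blast+
  have "trig_poly n k (\<lambda>\<phi>. \<Sum>y<2 ^ n. vec_index u y * w x y \<phi>)" if x: "x < 2 ^ n" for x
  proof (rule trig_poly_sum)
    fix y :: nat assume "y \<in> {..<2 ^ n}"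
    then have y: "y < 2 ^ n" by simp
    show "trig_poly n k (\<lambda>\<phi>. vec_index u y * w x y \<phi>)"
      using trig_poly_scale[OF w(1)[OF x y], of "vec_index u y"] u y
      by (cases "hamming_weight n y = k") (auto simp: weight_supported_def trig_poly.zero)
  qed
  moreover have "vec_index (Rz_layer n \<phi> *\<^sub>v u) x =
      cis (\<Sum>i<n. \<phi> i / 2) * (\<Sum>y<2 ^ n. vec_index u y * w x y \<phi>)" if x: "x < 2 ^ n" for x \<phi>
    unfolding mult_mat_vec_sum[OF Rz_layer_carrier uc x] sum_distrib_left
    by (intro sum.cong) (simp_all add: w(2)[OF x])
  ultimately show ?thesis
    using mult_mat_vec_carrier[OF Rz_layer_carrier uc] unfolding phased_trig_poly_def by blast
qed

section \<open>The loss as a function of the angles of one layer\<close>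

text \<open>The architecture enters only through perfect pairings, so butterfly and brick-wall are
  both instances.\<close>

locale weight_circuit =
  fixes n k K :: nat and pr :: "nat \<Rightarrow> nat \<Rightarrow> nat \<times> nat" and \<psi> :: "complex Matrix.vec"
    and M :: "complex mat"
  assumes supported: "weight_supported n k \<psi>"
    and M_carrier: "M \<in> carrier_mat (2 ^ n) (2 ^ n)"
    and pairing: "l \<in> {1..K} \<Longrightarrow> perfect_pairing n (pr l)"
begin

lemma \<psi>_carrier: "\<psi> \<in> carrier_vec (2 ^ n)"
  using supported by (simp add: weight_supported_def)

lemma circuit_state_split:
  assumes "l \<in> {1..K}"
  obtains A where "A \<in> carrier_mat (2 ^ n) (2 ^ n)"
    "\<And>c'. \<forall>m. m \<noteq> l \<longrightarrow> fst c' m = fst c m \<and> snd c' m = snd c m \<Longrightarrow>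
      circuit n pr K c' *\<^sub>v \<psi> = A *\<^sub>v (RBS_layer n (pr l) (fst c' l) *\<^sub>v
        (Rz_layer n (snd c' l) *\<^sub>v (circuit n pr (l - 1) c *\<^sub>v \<psi>)))"
proof -
  obtain A where A: "A \<in> carrier_mat (2 ^ n) (2 ^ n)" and
    eq: "\<And>c'. \<forall>m. m \<noteq> l \<longrightarrow> fst c' m = fst c m \<and> snd c' m = snd c m \<Longrightarrow>
      circuit n pr K c' =
        A * ((RBS_layer n (pr l) (fst c' l) * Rz_layer n (snd c' l)) * circuit n pr (l - 1) c)"
    using circuit_split[OF assms, of n c pr] by blast
  show ?thesis
  proof (rule that[OF A])
    fix c' assume "\<forall>m. m \<noteq> l \<longrightarrow> fst c' m = fst c m \<and> snd c' m = snd c m"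
    from eq[OF this] show "circuit n pr K c' *\<^sub>v \<psi> = A *\<^sub>v (RBS_layer n (pr l) (fst c' l) *\<^sub>v
        (Rz_layer n (snd c' l) *\<^sub>v (circuit n pr (l - 1) c *\<^sub>v \<psi>)))"
      using A \<psi>_carrier RBS_layer_carrier Rz_layer_carrier circuit_carrier[of n pr "l - 1" c]
      by (simp add: assoc_mult_mat_vec[of _ "2 ^ n" "2 ^ n" _ "2 ^ n"]
          mult_carrier_mat[of _ "2 ^ n" "2 ^ n"])
  qed
qed

text \<open>The RBS gates of layer \<open>l\<close> receive a state of weight \<open>k\<close>,
  since the earlier layers and the \<open>R_z\<close> gates of the same layer preserve weight; all
  later layers form a constant matrix.\<close>

lemma loss_trig_poly_RBS:
  assumes l: "l \<in> {1..K}"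
  shows "\<exists>F. trig_poly (n div 2) (2 * k) F \<and>
    (\<forall>\<theta>. loss n pr K M \<psi> ((fst c)(l := \<theta>), snd c) = Re (F \<theta>))"
proof -
  let ?U = "\<lambda>\<theta>. circuit n pr K ((fst c)(l := \<theta>), snd c)"
  obtain A where A: "A \<in> carrier_mat (2 ^ n) (2 ^ n)" and
    eq: "\<And>c'. \<forall>m. m \<noteq> l \<longrightarrow> fst c' m = fst c m \<and> snd c' m = snd c m \<Longrightarrow>
      circuit n pr K c' *\<^sub>v \<psi> = A *\<^sub>v (RBS_layer n (pr l) (fst c' l) *\<^sub>v
        (Rz_layer n (snd c' l) *\<^sub>v (circuit n pr (l - 1) c *\<^sub>v \<psi>)))"
    using circuit_state_split[OF l] by metis
  have "weight_supported n k (circuit n pr (l - 1) c *\<^sub>v \<psi>)"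
    using l pairing by (intro weight_supported_circuit supported) auto
  then have "weight_supported n k (Rz_layer n (snd c l) *\<^sub>v (circuit n pr (l - 1) c *\<^sub>v \<psi>))"
    by (rule weight_supported_Rz_layer)
  from phased_trig_poly_mult[OF A phased_trig_poly_RBS_layer[OF pairing[OF l] this]]
  have "phased_trig_poly (n div 2) k (2 ^ n) (\<lambda>_. 1) (\<lambda>\<theta>. ?U \<theta> *\<^sub>v \<psi>)"
    using eq[of "((fst c)(l := \<theta>), snd c)" for \<theta>] by simp
  from phased_trig_poly_expectation[OF M_carrier circuit_carrier \<psi>_carrier this] show ?thesis
    by (intro exI conjI) (auto simp: loss_def Let_def)
qed

text \<open>Within layer \<open>l\<close> the RBS gates follow the \<open>R_z\<close> gates, so they
  join the later layers as matrices constant in \<open>\<phi>\<close>.\<close>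

lemma loss_trig_poly_Rz:
  assumes l: "l \<in> {1..K}"
  shows "\<exists>F. trig_poly n (2 * k) F \<and>
    (\<forall>\<phi>. loss n pr K M \<psi> (fst c, (snd c)(l := \<phi>)) = Re (F \<phi>))"
proof -
  let ?U = "\<lambda>\<phi>. circuit n pr K (fst c, (snd c)(l := \<phi>))"
  obtain A where A: "A \<in> carrier_mat (2 ^ n) (2 ^ n)" and
    eq: "\<And>c'. \<forall>m. m \<noteq> l \<longrightarrow> fst c' m = fst c m \<and> snd c' m = snd c m \<Longrightarrow>
      circuit n pr K c' *\<^sub>v \<psi> = A *\<^sub>v (RBS_layer n (pr l) (fst c' l) *\<^sub>v
        (Rz_layer n (snd c' l) *\<^sub>v (circuit n pr (l - 1) c *\<^sub>v \<psi>)))"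
    using circuit_state_split[OF l] by metis
  have "weight_supported n k (circuit n pr (l - 1) c *\<^sub>v \<psi>)"
    using l pairing by (intro weight_supported_circuit supported) auto
  from phased_trig_poly_mult[OF A phased_trig_poly_mult[OF RBS_layer_carrier
      phased_trig_poly_Rz_layer[OF this]]]
  have "phased_trig_poly n k (2 ^ n) (\<lambda>\<phi>. cis (\<Sum>i<n. \<phi> i / 2)) (\<lambda>\<phi>. ?U \<phi> *\<^sub>v \<psi>)"
    using eq[of "(fst c, (snd c)(l := \<phi>))" for \<phi>] by simp
  from phased_trig_poly_expectation[OF M_carrier circuit_carrier \<psi>_carrier this] show ?thesis
    by (intro exI conjI) (auto simp: loss_def Let_def)
qed

end

section \<open>Cost and unbiasedness of the gradient estimate\<close>

lemma evals_for_each: "evals L (for_each xs f) = (\<Sum>x\<leftarrow>xs. evals L (f x))"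
  by (induction xs) (simp_all add: evals_bind)

text \<open>Each of the \<open>k\<close> shifts costs one difference, that is two evaluations,
  shared by all parameters of the layer; the signs are multiplied in afterwards.\<close>

lemma evals_layer_estimate: "evals L (layer_estimate k a r sh l s) = 2 * k"
  by (simp add: layer_estimate_def evals_bind evals_for_each difference_def sum_list_triv
      del: upt_Suc)

lemma evals_RBS_estimate: "evals L (RBS_estimate k a r K c S) = 2 * k * K"
  and evals_Rz_estimate: "evals L (Rz_estimate k a r K c S) = 2 * k * K"
  by (simp_all add: RBS_estimate_def Rz_estimate_def evals_for_each evals_layer_estimate
      sum_list_triv del: upt_Suc)

lemma evals_gradient_estimate: "evals L (gradient_estimate k a r K c S) = 4 * k * K"
  by (simp add: gradient_estimate_def evals_bind evals_RBS_estimate evals_Rz_estimate)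

text \<open>For even \<open>n\<close>, both the \<open>n div 2\<close> RBS angles at cost 4 and the
  \<open>n\<close> \<open>R_z\<close> angles at cost 2 contribute \<open>2 * n\<close> per
  layer.\<close>

lemma evals_naive_gradient:
  assumes "even n"
  shows "evals L (naive_gradient n K c) = 4 * n * K"
proof -
  have "evals L (naive_RBS c p) = 4" "evals L (naive_Rz c p) = 2" for p
    by (simp_all add: naive_RBS_def naive_Rz_def difference_def evals_bind Let_def split: prod.split)
  moreover have "4 * (n div 2) = 2 * n" using assms by auto
  ultimately show ?thesis
    by (simp add: naive_gradient_def evals_bind evals_for_each sum_list_triv algebra_simps
        del: upt_Suc)
qed

lemma card_trainable_parameters:
  assumes "even n"
  shows "real (card (trainable_parameters n K)) = 3 / 2 * real n * real K"
proof -
  have "card (trainable_parameters n K) = K * (n div 2) + K * n"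
    by (simp add: trainable_parameters_def card_Plus card_cartesian_product)
  then show ?thesis using assms by (auto simp: algebra_simps)
qed

section \<open>Expectations over the seed and unbiasedness\<close>

lemma map_pmf_layer_signs:
  "l \<in> {1..K} \<Longrightarrow> map_pmf (\<lambda>S. S l) (layer_signs K m) = pmf_of_set (sign_vectors m)"
  unfolding layer_signs_def by (subst Pi_pmf_component) auto

text \<open>An estimate in layer \<open>l\<close> sees the seed only through the sign vector of that
  layer, whose marginal is uniform.\<close>

lemma expectation_seed_pmf_fst:
  fixes f :: "(nat \<Rightarrow> real) \<Rightarrow> real"
  assumes "l \<in> {1..K}"
  shows "measure_pmf.expectation (seed_pmf n K) (\<lambda>S. f (fst S l)) =
    measure_pmf.expectation (pmf_of_set (sign_vectors (n div 2))) f"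
proof -
  have "map_pmf (\<lambda>S. fst S l) (seed_pmf n K) = map_pmf (\<lambda>S. S l) (map_pmf fst (seed_pmf n K))"
    by (simp add: pmf.map_comp o_def)
  also have "\<dots> = pmf_of_set (sign_vectors (n div 2))"
    by (simp add: seed_pmf_def map_fst_pair_pmf map_pmf_layer_signs[OF assms])
  finally show ?thesis
    using integral_map_pmf[of "\<lambda>S. fst S l" "seed_pmf n K" f] by simp
qed

lemma expectation_seed_pmf_snd:
  fixes f :: "(nat \<Rightarrow> real) \<Rightarrow> real"
  assumes "l \<in> {1..K}"
  shows "measure_pmf.expectation (seed_pmf n K) (\<lambda>S. f (snd S l)) =
    measure_pmf.expectation (pmf_of_set (sign_vectors n)) f"
proof -
  have "map_pmf (\<lambda>S. snd S l) (seed_pmf n K) = map_pmf (\<lambda>S. S l) (map_pmf snd (seed_pmf n K))"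
    by (simp add: pmf.map_comp o_def)
  also have "\<dots> = pmf_of_set (sign_vectors n)"
    by (simp add: seed_pmf_def map_snd_pair_pmf map_pmf_layer_signs[OF assms])
  finally show ?thesis
    using integral_map_pmf[of "\<lambda>S. snd S l" "seed_pmf n K" f] by simp
qed

lemma run_gradient_estimate:
  assumes "l \<in> {1..K}"
  shows "fst (run L (gradient_estimate k a r K c S)) l =
      run L (layer_estimate k a r (shift_RBS c) l (fst S l))"
    and "snd (run L (gradient_estimate k a r K c S)) l =
      run L (layer_estimate k a r (shift_Rz c) l (snd S l))"
proof -
  have "l \<in> set [1..<Suc K]" using assms by auto
  then show "fst (run L (gradient_estimate k a r K c S)) l =
      run L (layer_estimate k a r (shift_RBS c) l (fst S l))"
    "snd (run L (gradient_estimate k a r K c S)) l =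
      run L (layer_estimate k a r (shift_Rz c) l (snd S l))"
    by (simp_all add: gradient_estimate_def run_bind RBS_estimate_def Rz_estimate_def run_for_each
        del: upt_Suc)
qed

lemma (in weight_circuit) gradient_estimate_unbiased:
  assumes ar: "shift_coefficients k a r"
  shows "unbiased_gradient n K (loss n pr K M \<psi>) c (seed_pmf n K) (gradient_estimate k a r K c)"
  unfolding unbiased_gradient_def
proof (intro ballI conjI allI impI)
  fix l j assume l: "l \<in> {1..K}" and j: "j < n div 2"
  obtain F where F: "trig_poly (n div 2) (2 * k) F"
    and L: "\<And>\<theta>. loss n pr K M \<psi> ((fst c)(l := \<theta>), snd c) = Re (F \<theta>)"
    using loss_trig_poly_RBS[OF l] by blast
  show "((\<lambda>t. loss n pr K M \<psi> ((fst c)(l := (fst c l)(j := t)), snd c)) has_real_derivative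
      measure_pmf.expectation (seed_pmf n K)
        (\<lambda>S. fst (run (loss n pr K M \<psi>) (gradient_estimate k a r K c S)) l j)) (at (fst c l j))"
    \<comment> \<open>The instance \<open>f\<close> is the estimator of parameter \<open>j\<close>
      as a function of the sign vector of layer \<open>l\<close> alone.\<close>
    unfolding run_gradient_estimate[OF l] run_layer_estimate shift_RBS_def L
      expectation_seed_pmf_fst[OF l, where f = "\<lambda>s. s j * (\<Sum>q=1..k. a q *
        (Re (F (\<lambda>i. fst c l i + r q * s i)) - Re (F (\<lambda>i. fst c l i + - (r q * s i)))))"]
    by (rule parallel_shift_unbiased[OF F ar j])
next
  fix l i assume l: "l \<in> {1..K}" and i: "i < n"
  obtain F where F: "trig_poly n (2 * k) F"
    and L: "\<And>\<phi>. loss n pr K M \<psi> (fst c, (snd c)(l := \<phi>)) = Re (F \<phi>)"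
    using loss_trig_poly_Rz[OF l] by blast
  show "((\<lambda>t. loss n pr K M \<psi> (fst c, (snd c)(l := (snd c l)(i := t)))) has_real_derivative
      measure_pmf.expectation (seed_pmf n K)
        (\<lambda>S. snd (run (loss n pr K M \<psi>) (gradient_estimate k a r K c S)) l i)) (at (snd c l i))"
    unfolding run_gradient_estimate[OF l] run_layer_estimate shift_Rz_def L
      expectation_seed_pmf_snd[OF l, where f = "\<lambda>s. s i * (\<Sum>q=1..k. a q *
        (Re (F (\<lambda>j. snd c l j + r q * s j)) - Re (F (\<lambda>j. snd c l j + - (r q * s j)))))"]
    by (rule parallel_shift_unbiased[OF F ar i])
qed

theorem corollary27:
  fixes n k :: nat and \<psi> :: "complex Matrix.vec" and M :: "complex mat"
    and a r :: "nat \<Rightarrow> real" and c :: config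
  assumes "input_state n k \<psi>"
    and "preserving_observable n M"
    and "shift_coefficients k a r"
  shows "(\<forall>K pr. K \<ge> 1 \<and> n = 2 ^ K \<and> butterfly_pairing K pr \<longrightarrow>
      (let L = loss n pr K M \<psi> in
        real K = log 2 (real n) \<and>
        real (card (trainable_parameters n K)) = 3 / 2 * real n * log 2 (real n) \<and>
        unbiased_gradient n K L c (seed_pmf n K) (gradient_estimate k a r K c) \<and>
        (\<forall>l s. evals L (layer_estimate k a r (shift_RBS c) l s) = 2 * k \<and>
               evals L (layer_estimate k a r (shift_Rz c) l s) = 2 * k) \<and>
        (\<forall>S. real (evals L (RBS_estimate k a r K c (fst S))) = 2 * real k * log 2 (real n) \<and>
             real (evals L (Rz_estimate k a r K c (snd S))) = 2 * real k * log 2 (real n) \<and>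
             real (evals L (gradient_estimate k a r K c S)) = 4 * real k * log 2 (real n) \<and>
             (k \<ge> 1 \<longrightarrow> real (evals L (naive_gradient n K c))
                / real (evals L (gradient_estimate k a r K c S)) = real n / real k) \<and>
             (k = 60 \<longrightarrow>
                real (evals L (gradient_estimate k a r K c S)) = 240 * log 2 (real n))) \<and>
        real (evals L (naive_gradient n K c)) = 4 * real n * log 2 (real n))) \<and>
    (even n \<and> n \<ge> 2 \<longrightarrow>
      (let L = loss n (brickwall n) n M \<psi> in
        real (card (trainable_parameters n n)) = 3 * real n ^ 2 / 2 \<and>
        unbiased_gradient n n L c (seed_pmf n n) (gradient_estimate k a r n c) \<and>
        (\<forall>l s. evals L (layer_estimate k a r (shift_RBS c) l s) = 2 * k \<and>
               evals L (layer_estimate k a r (shift_Rz c) l s) = 2 * k) \<and>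
        (\<forall>S. evals L (RBS_estimate k a r n c (fst S)) = 2 * k * n \<and>
             evals L (Rz_estimate k a r n c (snd S)) = 2 * k * n \<and>
             evals L (gradient_estimate k a r n c S) = 4 * k * n \<and>
             (k \<ge> 1 \<longrightarrow> real (evals L (naive_gradient n n c))
                / real (evals L (gradient_estimate k a r n c S)) = real n / real k)) \<and>
        evals L (naive_gradient n n c) = 4 * n ^ 2))"
proof -
  have supp: "weight_supported n k \<psi>" and M: "M \<in> carrier_mat (2 ^ n) (2 ^ n)"
    using assms(1,2)
    by (simp_all add: input_state_def preserving_observable_def weight_supported_weight_subspace)
  \<comment> \<open>Proved once for arbitrary perfect pairings and any number of layers, then used
    for both architectures.\<close>
  have unbiased: "unbiased_gradient n K (loss n pr K M \<psi>) c (seed_pmf n K) (gradient_estimate k a r K c)"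
    if "\<And>l. l \<in> {1..K} \<Longrightarrow> perfect_pairing n (pr l)" for K pr
  proof -
    interpret weight_circuit n k K pr \<psi> M
      using supp M that by unfold_locales
    show ?thesis by (rule gradient_estimate_unbiased[OF assms(3)])
  qed
  note counts = evals_layer_estimate evals_RBS_estimate evals_Rz_estimate evals_gradient_estimate
    evals_naive_gradient card_trainable_parameters
  show ?thesis
    unfolding Let_def
  proof (rule conjI, goal_cases butterfly brickwall)
    case butterfly
    show ?case
    proof (intro allI impI, elim conjE, goal_cases)
      case (1 K pr)
      then have "real K = log 2 (real n)" "even n" "n > 0"
        by simp_all
      moreover have "unbiased_gradient n K (loss n pr K M \<psi>) c (seed_pmf n K)
          (gradient_estimate k a r K c)"
        using 1 by (intro unbiased) (simp add: butterfly_pairing_def)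
      \<comment> \<open>Replacing \<open>log 2 (real n)\<close> by \<open>real K\<close> leaves
        arithmetic on the counts; \<open>K \<ge> 1\<close> keeps the denominator of the reduction
        factor nonzero.\<close>
      ultimately show ?case
        using 1(1) by (simp add: counts divide_simps flip: \<open>real K = log 2 (real n)\<close>)
    qed
  next
    case brickwall
    show ?case
    proof (intro impI, elim conjE, goal_cases)
      case 1
      then have "unbiased_gradient n n (loss n (brickwall n) n M \<psi>) c (seed_pmf n n)
          (gradient_estimate k a r n c)"
        by (intro unbiased perfect_pairing_brickwall)
      then show ?case
        using 1 by (simp add: counts divide_simps power2_eq_square)
    qed
  qed
qed

end
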